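(* Let $1\le l\le k$ be integers. In the $l$ vs $k$ game, a (possibly mixed) strategy profile $(x_1,x_2)\in\Delta(S_1)\times\Delta(S_2)$ is a Nash equilibrium if and only if both of the following hold: (C1) $x_1$ is an $(l,k)$-SOI strategy; and (C2) $x_2=o^k$ (i.e. $x_2$ is the pure strategy $o^k$).
   Context: Customers are uniformly distributed on $[0,1]$. For integers $1\le l\le k$, the $l$ vs $k$ game is the following two-player game. Set $n_1=l$, $n_2=k$. The pure strategy set of player $i\in\{1,2\}$ is $S_i=\{(s_i^1,\dots,s_i^{n_i})\in[0,1]^{n_i}: s_i^1<\dots<s_i^{n_i}\}$; a pure strategy is identified with the set of its $n_i$ coordinates (facility locations). For a pure profile $\mathbf s=(s_1,s_2)$ and a customer $t\in[0,1]$, let $r_t(\mathbf s)=\{i\in\{1,2\}: \min_{f\in s_i}|t-f|\le \min_{f\in s_1\cup s_2}|t-f|\}$. The payoff is $u_i(\mathbf s)=\int_0^1 \frac{\mathbf 1[i\in r_t(\mathbf s)]}{|r_t(\mathbf s)|}\,dt$. $\Delta(S_i)$ is the set of Borel probability measures on $S_i$ (mixed strategies; a pure strategy is identified with its point mass), and $u_i(\mathbf x)=\mathbb E_{\mathbf s\sim\mathbf x}u_i(\mathbf s)$ for $\mathbf x=(x_1,x_2)\in\Delta(S_1)\times\Delta(S_2)$, with $s_1\sim x_1$, $s_2\sim x_2$ independent. A profile $(x_1,x_2)$ is a Nash equilibrium if no player can strictly increase her payoff by a unilateral change of mixed strategy. $k$-socially optimal locations: $o^k=\{o_1^k,\dots,o_k^k\}$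 with $o_i^k=\frac{2i-1}{2k}$; note $o^k\in S_2$. For $x\in\Delta(S_1)$ and a Borel set $A\subseteq[0,1]$, $\mu_x(A)=\mathbb E_{(s_1^1,\dots,s_1^l)\sim x}\big[\sum_{i=1}^l\mathbf 1[s_1^i\in A]\big]$ is the expected number of player 1's facilities in $A$. A strategy $x\in\Delta(S_1)$ is an $(l,k)$-SOI (socially optimal imitation) strategy if $\mu_x(\{o_i^k\})=\frac lk$ for every $i\in\{1,\dots,k\}$. *)

theory Defs
  imports "HOL-Probability.Probability"
begin

text \<open>
  A pure strategy with \<open>n\<close> facilities is a strictly increasing \<open>n\<close>-tuple in \<open>[0,1]\<close>, encoded as
  a function on \<open>{1..n}\<close> (extended by \<^const>\<open>undefined\<close> elsewhere).
\<close>

definition pure_strategies :: "nat \<Rightarrow> (nat \<Rightarrow> real) set" where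
  "pure_strategies n = {s \<in> {1..n} \<rightarrow>\<^sub>E {0..1}. strict_mono_on {1..n} s}"

definition facilities :: "nat \<Rightarrow> (nat \<Rightarrow> real) \<Rightarrow> real set" where
  "facilities n s = s ` {1..n}"

text \<open>
  The product of the Borel sigma-algebras over the finite index set \<open>{1..n}\<close> is the Borel
  sigma-algebra of \<open>\<real>\<^sup>n\<close>; its restriction is the Borel sigma-algebra of the pure strategy set.
  Only the sigma-algebra of this measure is used.
\<close>

definition strategy_space :: "nat \<Rightarrow> (nat \<Rightarrow> real) measure" where
  "strategy_space n = restrict_space (PiM {1..n} (\<lambda>_. borel)) (pure_strategies n)"

definition mixed_strategies :: "nat \<Rightarrow> (nat \<Rightarrow> real) measure set" where
  "mixed_strategies n = {x. prob_space x \<and> sets x = sets (strategy_space n)}"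

text \<open>The players are \<open>1\<close> and \<open>2\<close>, with facility sets \<open>F1\<close> and \<open>F2\<close>.\<close>

definition closest_players :: "real set \<Rightarrow> real set \<Rightarrow> real \<Rightarrow> nat set" where
  "closest_players F1 F2 t =
     {i \<in> {1, 2}. Min ((\<lambda>f. \<bar>t - f\<bar>) ` (if i = 1 then F1 else F2))
                    \<le> Min ((\<lambda>f. \<bar>t - f\<bar>) ` (F1 \<union> F2))}"

definition pure_payoff ::
    "nat \<Rightarrow> nat \<Rightarrow> nat \<Rightarrow> (nat \<Rightarrow> real) \<times> (nat \<Rightarrow> real) \<Rightarrow> real" where
  "pure_payoff l k i s =
     (let r = closest_players (facilities l (fst s)) (facilities k (snd s))
      in LBINT t:{0..1}. indicator (r t) i / real (card (r t)))"

definition payoff ::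
    "nat \<Rightarrow> nat \<Rightarrow> nat \<Rightarrow> (nat \<Rightarrow> real) measure \<Rightarrow> (nat \<Rightarrow> real) measure \<Rightarrow> real" where
  "payoff l k i x1 x2 = (LINT s|(x1 \<Otimes>\<^sub>M x2). pure_payoff l k i s)"

definition nash_equilibrium ::
    "nat \<Rightarrow> nat \<Rightarrow> (nat \<Rightarrow> real) measure \<Rightarrow> (nat \<Rightarrow> real) measure \<Rightarrow> bool" where
  "nash_equilibrium l k x1 x2 \<longleftrightarrow>
     x1 \<in> mixed_strategies l \<and> x2 \<in> mixed_strategies k \<and>
     (\<forall>y \<in> mixed_strategies l. \<not> payoff l k 1 y x2 > payoff l k 1 x1 x2) \<and>
     (\<forall>y \<in> mixed_strategies k. \<not> payoff l k 2 x1 y > payoff l k 2 x1 x2)"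

definition soc_opt :: "nat \<Rightarrow> nat \<Rightarrow> real" where
  "soc_opt k = (\<lambda>i\<in>{1..k}. (2 * real i - 1) / (2 * real k))"

definition point_mass :: "nat \<Rightarrow> (nat \<Rightarrow> real) \<Rightarrow> (nat \<Rightarrow> real) measure" where
  "point_mass n s = return (strategy_space n) s"

definition expected_facilities :: "nat \<Rightarrow> (nat \<Rightarrow> real) measure \<Rightarrow> real set \<Rightarrow> real" where
  "expected_facilities l x A = (LINT s|x. (\<Sum>i=1..l. indicator A (s i)))"

definition SOI_strategy :: "nat \<Rightarrow> nat \<Rightarrow> (nat \<Rightarrow> real) measure \<Rightarrow> bool" where
  "SOI_strategy l k x \<longleftrightarrow> x \<in> mixed_strategies l \<and>
     (\<forall>i \<in> {1..k}. expected_facilities l x {soc_opt k i} = real l / real k)"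

lemma space_strategy_space: "space (strategy_space n) = pure_strategies n"
  by (auto simp: strategy_space_def space_restrict_space space_PiM pure_strategies_def PiE_def)

lemma soc_opt_in_pure_strategies: "soc_opt k \<in> pure_strategies k"
  by (auto simp: pure_strategies_def soc_opt_def strict_mono_on_def field_simps)

lemma point_mass_in_mixed_strategies:
  assumes "s \<in> pure_strategies n"
  shows "point_mass n s \<in> mixed_strategies n"
  using assms
  by (simp add: mixed_strategies_def point_mass_def prob_space_return space_strategy_space)

end

theory Submission
  imports Defs
begin

text \<open>
  The game has constant sum and its value is \<open>l / (2k)\<close>. A set \<open>F\<close> of facilities earns at most the
  sum of what its members earn on their own, and a single facility earns at most \<open>1 / (2k)\<close> against
  \<open>o\<^sup>k\<close>; hence \<open>m\<close> facilities earn at most \<open>m / (2k)\<close> against \<open>o\<^sup>k\<close>. Conversely, cut \<open>[0,1]\<close> into the \<open>k\<close>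
  cells with midpoints \<open>o\<^sub>j\<close>. Occupying \<open>o\<^sub>j\<close> secures at least the earnings \<open>c\<^sub>j\<close> of \<open>o\<^sub>j\<close> alone in its
  cell, and \<open>c\<^sub>1 + \<dots> + c\<^sub>k\<close> is at least the payoff of \<open>o\<^sup>k\<close>, which is at least \<open>1/2\<close>, with equality only against
  \<open>o\<^sup>k\<close> itself. So an SOI strategy secures \<open>l / (2k)\<close>, and in an equilibrium player 1 could
  occupy the \<open>l\<close> best cells, which forces player 2 to play \<open>o\<^sup>k\<close>.

  By subadditivity the SOI property in equilibrium only concerns the expected numbers \<open>\<mu>(A)\<close> of
  facilities of player 1 in \<open>A\<close>. Letting player 2 play a perturbation of \<open>o\<^sup>k\<close> with one gap
  shortened and the next one enlarged shows that \<open>\<mu>[o\<^sub>j, o\<^sub>j\<^sub>+\<^sub>1)\<close> is nondecreasing in \<open>j\<close>, so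
  \<open>\<mu>[o\<^sub>j, 1] \<ge> (k + 1 - j) l / k\<close>. Adding the mirrored bound \<open>\<mu>[0, o\<^sub>j] \<ge> j l / k\<close> gives
  \<open>\<mu>{o\<^sub>j} \<ge> l / k\<close>, with equality because \<open>\<mu>\<close> has total mass \<open>l\<close>.
\<close>

section \<open>Shares and gains\<close>

text \<open>The fraction of customer \<open>t\<close> that \<open>F\<close> wins against
  \<open>G\<close>. Stated with quantifiers rather than \<open>Min\<close>, it is 0 for empty
  \<open>F\<close>, which starts the induction in \<open>gain_subadditive\<close>, and its behaviour
  under inclusions and unions of \<open>F\<close> is plain logic.\<close>

definition share :: "real set \<Rightarrow> real set \<Rightarrow> real \<Rightarrow> real" where
  "share F G t = (if \<exists>f\<in>F. \<forall>g\<in>G. \<bar>t - f\<bar> < \<bar>t - g\<bar> then 1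
                  else if \<exists>f\<in>F. \<forall>g\<in>G. \<bar>t - f\<bar> \<le> \<bar>t - g\<bar> then 1/2 else 0)"

definition gain :: "real set \<Rightarrow> real set \<Rightarrow> real" where
  "gain F G = (LBINT t:{0..1}. share F G t)"

lemma share_bounds: "0 \<le> share F G t" "share F G t \<le> 1"
  by (auto simp: share_def)

lemma share_eq_Min:
  assumes F: "finite F" "F \<noteq> {}" and G: "finite G" "G \<noteq> {}"
  shows "share F G t = (let a = Min ((\<lambda>f. \<bar>t - f\<bar>) ` F); b = Min ((\<lambda>f. \<bar>t - f\<bar>) ` G)
           in if a < b then 1 else if a = b then 1/2 else 0)"
proof -
  have "Min ((\<lambda>f. \<bar>t - f\<bar>) ` F) \<in> (\<lambda>f. \<bar>t - f\<bar>) ` F"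
    using F by (intro Min_in) auto
  then obtain f where f: "f \<in> F" "Min ((\<lambda>f. \<bar>t - f\<bar>) ` F) = \<bar>t - f\<bar>"
    by blast
  then have f': "\<bar>t - f\<bar> \<le> \<bar>t - f'\<bar>" if "f' \<in> F" for f'
    by (metis F(1) Min_le finite_imageI imageI that)
  have "Min ((\<lambda>f. \<bar>t - f\<bar>) ` G) \<in> (\<lambda>f. \<bar>t - f\<bar>) ` G"
    using G by (intro Min_in) auto
  then obtain g where g: "g \<in> G" "Min ((\<lambda>f. \<bar>t - f\<bar>) ` G) = \<bar>t - g\<bar>"
    by blast
  then have g': "\<bar>t - g\<bar> \<le> \<bar>t - g'\<bar>" if "g' \<in> G" for g'
    by (metis G(1) Min_le finite_imageI imageI that)
  have "(\<exists>f\<in>F. \<forall>g\<in>G. \<bar>t - f\<bar> < \<bar>t - g\<bar>) \<longleftrightarrow> \<bar>t - f\<bar> < \<bar>t - g\<bar>"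
    using f(1) g(1) f' g' by (meson le_less_trans less_le_trans)
  moreover have "(\<exists>f\<in>F. \<forall>g\<in>G. \<bar>t - f\<bar> \<le> \<bar>t - g\<bar>) \<longleftrightarrow> \<bar>t - f\<bar> \<le> \<bar>t - g\<bar>"
    using f(1) g(1) f' g' by (meson order_trans)
  ultimately show ?thesis
    unfolding share_def Let_def f(2) g(2) by (simp add: order.order_iff_strict)
qed

lemma share_swap:
  assumes "finite F" "finite G" "F \<noteq> {}" "G \<noteq> {}"
  shows "share G F t = 1 - share F G t"
  unfolding share_eq_Min[OF assms(1,3,2,4)] share_eq_Min[OF assms(2,4,1,3)] Let_def
  by (auto simp del: Min_less_iff Min_gr_iff)

lemma closest_players_share:
  assumes F: "finite F" "F \<noteq> {}" and G: "finite G" "G \<noteq> {}"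
  shows "indicator (closest_players F G t) (1::nat) / real (card (closest_players F G t)) = share F G t"
    and "indicator (closest_players F G t) (2::nat) / real (card (closest_players F G t)) = 1 - share F G t"
proof -
  define a b where "a = Min ((\<lambda>f. \<bar>t - f\<bar>) ` F)" and "b = Min ((\<lambda>f. \<bar>t - f\<bar>) ` G)"
  have "Min ((\<lambda>f. \<bar>t - f\<bar>) ` (F \<union> G)) = min a b"
    using assms by (simp add: image_Un Min_Un a_def b_def)
  then have "closest_players F G t = {i \<in> {1, 2}. (if i = 1 then a else b) \<le> min a b}"
    by (auto simp: closest_players_def a_def b_def)
  also have "\<dots> = (if a < b then {1} else if a = b then {1, 2} else {2})"
    by (auto simp: min_def)
  finally have r: "closest_players F G t = (if a < b then {1} else if a = b then {1, 2} else {2})" .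
  have s: "share F G t = (if a < b then 1 else if a = b then 1/2 else 0)"
    using assms by (simp add: share_eq_Min a_def b_def Let_def)
  show "indicator (closest_players F G t) (1::nat) / real (card (closest_players F G t)) = share F G t"
    and "indicator (closest_players F G t) (2::nat) / real (card (closest_players F G t)) = 1 - share F G t"
    unfolding r s by (auto simp: card_insert_if)
qed

lemma measurable_share [measurable]:
  assumes [measurable]: "finite F" "finite G"
  shows "share F G \<in> borel_measurable borel"
  using assms unfolding share_def[abs_def] by measurable

lemma set_integrable_bounded:
  fixes f :: "real \<Rightarrow> real"
  assumes [measurable]: "f \<in> borel_measurable borel" and "\<And>t. \<bar>f t\<bar> \<le> B"
  shows "set_integrable lborel {a..b} f"
  unfolding set_integrable_def
  by (rule integrableI_bounded_set_indicator[where B = B]) (use assms in \<open>auto simp: emeasure_lborel_Icc_eq\<close>)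

lemma set_integrable_share:
  assumes "finite F" "finite G"
  shows "set_integrable lborel {a..b} (share F G)"
  by (rule set_integrable_bounded[where B = 1])
     (use assms in \<open>auto simp: share_bounds intro!: measurable_share\<close>)

lemma gain_bounds:
  assumes "finite F" "finite G"
  shows "0 \<le> gain F G" "gain F G \<le> 1"
proof -
  show "0 \<le> gain F G"
    unfolding gain_def set_lebesgue_integral_def
    by (rule integral_nonneg_AE) (auto simp: share_bounds)
  have "gain F G \<le> (LBINT t:{0..1::real}. 1)"
    unfolding gain_def
    by (rule set_integral_mono)
       (use assms in \<open>auto simp: share_bounds intro!: set_integrable_share set_integrable_bounded[where B = 1]\<close>)
  then show "gain F G \<le> 1" by (simp add: set_lebesgue_integral_def)
qed

lemma gain_swap:
  assumes "finite F" "finite G" "F \<noteq> {}" "G \<noteq> {}"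
  shows "gain G F = 1 - gain F G"
proof -
  have "gain G F = (LBINT t:{0..1}. 1 - share F G t)"
    by (simp add: gain_def share_swap[OF assms])
  also have "\<dots> = 1 - gain F G"
    unfolding gain_def using assms(1,2)
    by (subst set_integral_diff)
       (auto intro!: set_integrable_bounded[where B = 1] measurable_share simp: share_bounds set_lebesgue_integral_def)
  finally show ?thesis .
qed

lemma gain_Un_le:
  assumes "finite F" "finite F'" "finite G"
  shows "gain (F \<union> F') G \<le> gain F G + gain F' G"
proof -
  have "share (F \<union> F') G t \<le> share F G t + share F' G t" for t
    by (auto simp: share_def)
  then have "gain (F \<union> F') G \<le> (LBINT t:{0..1}. share F G t + share F' G t)"
    unfolding gain_def
    by (intro set_integral_mono set_integral_add(1)) (use assms set_integrable_share in auto)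
  then show ?thesis
    unfolding gain_def using assms by (simp add: set_integral_add set_integrable_share)
qed

lemma gain_subadditive:
  assumes "finite F" "finite G"
  shows "gain F G \<le> (\<Sum>a\<in>F. gain {a} G)"
  using assms(1)
proof (induction F rule: finite_induct)
  case empty
  then show ?case by (simp add: gain_def share_def)
next
  case (insert a F)
  then show ?case
    using gain_Un_le[of "{a}" F G] assms(2) by simp
qed

text \<open>Customers equally well served by two facilities are counted twice by the sum of the
  individual gains.\<close>

lemma gain_pair_overlap:
  assumes "finite G" "p < q" "{p..q} \<subseteq> {0..1}"
    and "\<And>t g. t \<in> {p..q} \<Longrightarrow> g \<in> G \<Longrightarrow> \<bar>t - a\<bar> \<le> \<bar>t - g\<bar> \<and> \<bar>t - b\<bar> \<le> \<bar>t - g\<bar>"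
  shows "gain {a, b} G < gain {a} G + gain {b} G"
proof -
  \<comment> \<open>On the overlap both single shares are at least 1/2 and the share of the pair is
    at most their maximum, so the sum of the single shares exceeds it by at least 1/2.\<close>
  have "share {a, b} G t + indicator {p..q} t / 2 \<le> share {a} G t + share {b} G t" for t
  proof (cases "t \<in> {p..q}")
    case True
    then have "share {a} G t \<ge> 1/2" "share {b} G t \<ge> 1/2"
      using assms(4) by (auto simp: share_def)
    moreover have "share {a, b} G t \<le> max (share {a} G t) (share {b} G t)"
      by (auto simp: share_def)
    ultimately show ?thesis using True by auto
  next
    case False
    then show ?thesis by (auto simp: share_def)
  qed
  moreover have i: "set_integrable lborel {0..1} (\<lambda>t. indicator {p..q} t / 2 :: real)"
    by (rule set_integrable_bounded[where B = 1]) (auto simp: indicator_def)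
  ultimately have "(LBINT t:{0..1}. share {a, b} G t + indicator {p..q} t / 2)
      \<le> (LBINT t:{0..1}. share {a} G t + share {b} G t)"
    by (intro set_integral_mono set_integral_add(1)) (use assms set_integrable_share in auto)
  then have "gain {a, b} G + (LBINT t:{0..1}. indicator {p..q} t / 2 :: real) \<le> gain {a} G + gain {b} G"
    unfolding gain_def using i assms(1)
    by (simp add: set_integral_add set_integrable_share)
  moreover have "(LBINT t:{0..1}. indicator {p..q} t / 2 :: real) = (q - p) / 2"
  proof -
    have "(LBINT t:{0..1}. indicator {p..q} t / 2 :: real) = (\<integral>t. indicator {p..q} t / 2 \<partial>lborel :: real)"
      unfolding set_lebesgue_integral_def
      by (rule Bochner_Integration.integral_cong) (use assms(3) in \<open>auto simp: indicator_def\<close>)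
    also have "\<dots> = (q - p) / 2" using assms(2) by simp
    finally show ?thesis .
  qed
  moreover have "0 < (q - p) / 2"
    using assms(2) by simp
  ultimately show ?thesis by linarith
qed

text \<open>If \<open>a\<close> is also a location of the opponent, then its customers are shared, whence \<open>c = 1/2\<close>.\<close>

lemma gain_singleton_le:
  assumes "finite G" "L \<le> H" "0 \<le> c" "a \<in> G \<Longrightarrow> c = 1/2" "a \<notin> G \<Longrightarrow> c = 1"
    and "\<And>t. t \<in> {0..1} \<Longrightarrow> (\<And>g. g \<in> G \<Longrightarrow> \<bar>t - a\<bar> \<le> \<bar>t - g\<bar>) \<Longrightarrow> L \<le> t \<and> t \<le> H"
  shows "gain {a} G \<le> c * (H - L)"
proof -
  have "indicator {0..1} t * share {a} G t \<le> c * indicator {L..H} t" for t :: real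
  proof (cases "t \<in> {0..1} \<and> (\<forall>g\<in>G. \<bar>t - a\<bar> \<le> \<bar>t - g\<bar>)")
    case True
    then have "t \<in> {L..H}" using assms(6) by auto
    moreover have "share {a} G t \<le> c" using assms(4,5) by (force simp: share_def)
    ultimately show ?thesis using True by auto
  next
    case False
    then have "t \<notin> {0..1} \<or> share {a} G t = 0" by (auto simp: share_def intro: less_imp_le)
    then show ?thesis using assms(3) by auto
  qed
  then have "gain {a} G \<le> (\<integral>t. c * indicator {L..H} t \<partial>lborel)"
    unfolding gain_def set_lebesgue_integral_def
    by (intro integral_mono) (use assms(1,2) set_integrable_share[of "{a}" G] in \<open>auto simp: set_integrable_def\<close>)
  also have "\<dots> = c * (H - L)" using assms(2) by simp
  finally show ?thesis .
qed

section \<open>Gain of a single facility\<close>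

text \<open>The bounds \<open>p\<close> and \<open>q\<close> are the neighbouring locations of \<open>a\<close> in \<open>G\<close>; next to an end point
  of \<open>[0,1]\<close> they are reflections of \<open>a\<close> or of a location beyond it.\<close>

lemma gain_le_gap:
  assumes "finite G" "p \<le> q"
    and "p \<in> G \<and> p < a \<or> p + a \<le> 0"
    and "q \<in> G \<and> a < q \<or> q + a \<ge> 2"
  shows "a \<notin> G \<Longrightarrow> gain {a} G \<le> (q - p) / 2" and "a \<in> G \<Longrightarrow> gain {a} G \<le> (q - p) / 4"
proof -
  \<comment> \<open>Customers for whom \<open>a\<close> is nearest lie between the midpoints of
    \<open>a\<close> with \<open>p\<close> and with \<open>q\<close>, which are (q - p) / 2 apart.
    For a reflection the midpoint is at or beyond an end point of [0,1].\<close>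
  have *: "(p + a) / 2 \<le> t \<and> t \<le> (a + q) / 2"
    if "t \<in> {0..1}" and near: "\<And>g. g \<in> G \<Longrightarrow> \<bar>t - a\<bar> \<le> \<bar>t - g\<bar>" for t
  proof
    show "(p + a) / 2 \<le> t"
      using assms(3) that(1) near[of p] by (auto split: abs_split)
    show "t \<le> (a + q) / 2"
      using assms(4) that(1) near[of q] by (auto split: abs_split)
  qed
  show "a \<notin> G \<Longrightarrow> gain {a} G \<le> (q - p) / 2"
    using gain_singleton_le[of G "(p + a) / 2" "(a + q) / 2" 1 a] assms(1,2) *
    by (auto simp: field_simps)
  show "a \<in> G \<Longrightarrow> gain {a} G \<le> (q - p) / 4"
    using gain_singleton_le[of G "(p + a) / 2" "(a + q) / 2" "1/2" a] assms(1,2) *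
    by (auto simp: field_simps)
qed

lemma slot_exists:
  fixes \<tau> :: "nat \<Rightarrow> real"
  assumes "1 \<le> k"
  obtains "a < \<tau> 1" | i where "i \<in> {1..k}" "\<tau> i \<le> a" "i < k \<Longrightarrow> a < \<tau> (Suc i)"
proof -
  have "a < \<tau> 1 \<or> (\<exists>i\<in>{1..k}. \<tau> i \<le> a \<and> (i < k \<longrightarrow> a < \<tau> (Suc i)))"
    using assms
  proof (induction k rule: nat_induct_at_least)
    case base then show ?case by auto
  next
    case (Suc k)
    show ?case
    proof (cases "\<tau> (Suc k) \<le> a")
      case True then show ?thesis by (intro disjI2 bexI[of _ "Suc k"]) auto
    next
      case False
      with Suc.IH show ?thesis
        by (metis atLeastAtMost_iff le_SucI less_Suc_eq_le linorder_not_le nat_less_le)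
    qed
  qed
  then show ?thesis using that by blast
qed

locale locations =
  fixes k :: nat and \<tau> :: "nat \<Rightarrow> real"
  assumes k: "1 \<le> k" and \<tau>: "strict_mono_on {1..k} \<tau>" "\<tau> ` {1..k} \<subseteq> {0..1}"
begin

text \<open>The values at 0 and \<open>Suc k\<close> are the reflections of the outermost locations
  in 0 and in 1. They meet the reflection alternatives of \<open>gain_le_gap\<close>, so the last
  gap and the outermost locations are treated like inner ones.\<close>

definition ext :: "nat \<Rightarrow> real" where
  "ext i = (if i = 0 then - \<tau> 1 else if i = Suc k then 2 - \<tau> k else \<tau> i)"

text \<open>With no location to the left of \<open>a\<close>, the left bound in
  \<open>gain_le_gap\<close> is the reflection \<open>-a\<close>.\<close>

lemma gain_first_gap: "0 \<le> a \<Longrightarrow> a < \<tau> 1 \<Longrightarrow> gain {a} (\<tau> ` {1..k}) \<le> (a + \<tau> 1) / 2"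
proof -
  assume a: "0 \<le> a" "a < \<tau> 1"
  have "\<tau> 1 \<le> \<tau> i" if "i \<in> {1..k}" for i
    using \<tau>(1) that k by (cases "i = 1") (auto simp: strict_mono_on_def intro: less_imp_le)
  then have "a \<notin> \<tau> ` {1..k}" using a by force
  then show ?thesis
    using gain_le_gap(1)[of "\<tau> ` {1..k}" "-a" "\<tau> 1" a] a k by (auto simp: add.commute)
qed

text \<open>Strictly inside a gap, \<open>a\<close> wins an interval of half the gap's length,
  wherever it lies. On a location it wins half of each adjacent gap but shares these customers,
  hence the divisor 4. Beyond \<open>\<tau> k\<close>, reflecting \<open>a\<close> itself gives the
  sharper \<open>gain_last_gap\<close>.\<close>

lemma
  assumes i: "i \<in> {1..k}" "i < k \<Longrightarrow> a < \<tau> (Suc i)" and a: "a \<le> 1"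
  shows gain_gap: "\<tau> i < a \<Longrightarrow> gain {a} (\<tau> ` {1..k}) \<le> (ext (Suc i) - ext i) / 2"
    and gain_last_gap: "\<tau> i < a \<Longrightarrow> i = k \<Longrightarrow> gain {a} (\<tau> ` {1..k}) \<le> (2 - a - \<tau> k) / 2"
    and gain_at_location: "\<tau> i = a \<Longrightarrow> gain {a} (\<tau> ` {1..k}) \<le> (ext (Suc i) - ext (i - 1)) / 4"
proof -
  have mono: "\<tau> i < \<tau> j" if "i \<in> {1..k}" "j \<in> {1..k}" "i < j" for i j
    using \<tau>(1) that by (auto simp: strict_mono_on_def)
  have ge0: "0 \<le> \<tau> i" "\<tau> i \<le> 1" if "i \<in> {1..k}" for i
    using \<tau>(2) that unfolding image_subset_iff by auto
  {
    assume less: "\<tau> i < a"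
    have notin: "a \<notin> \<tau> ` {1..k}"
    proof
      assume "a \<in> \<tau> ` {1..k}"
      then obtain j where j: "j \<in> {1..k}" "a = \<tau> j" by auto
      with less mono[of j i] i have "i < j" by (metis less_asym nat_neq_iff)
      then have "\<tau> (Suc i) \<le> \<tau> j" using mono[of "Suc i" j] j i by (cases "j = Suc i") auto
      then show False using i j \<open>i < j\<close> by auto
    qed
    show "gain {a} (\<tau> ` {1..k}) \<le> (ext (Suc i) - ext i) / 2"
    proof (rule gain_le_gap(1)[OF _ _ _ _ notin])
      show "ext i \<in> \<tau> ` {1..k} \<and> ext i < a \<or> ext i + a \<le> 0"
        using less i by (auto simp: ext_def)
      show "ext (Suc i) \<in> \<tau> ` {1..k} \<and> a < ext (Suc i) \<or> 2 \<le> ext (Suc i) + a"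
        using less i by (auto simp: ext_def)
      show "ext i \<le> ext (Suc i)"
        using less i a by (cases "i = k") (auto simp: ext_def)
    qed auto
    show "gain {a} (\<tau> ` {1..k}) \<le> (2 - a - \<tau> k) / 2" if "i = k"
      by (rule gain_le_gap(1)[OF _ _ _ _ notin]) (use less i a that in auto)
  }
  assume eq: "\<tau> i = a"
  show "gain {a} (\<tau> ` {1..k}) \<le> (ext (Suc i) - ext (i - 1)) / 4"
  proof (rule gain_le_gap(2))
    show p: "ext (i - 1) \<in> \<tau> ` {1..k} \<and> ext (i - 1) < a \<or> ext (i - 1) + a \<le> 0"
    proof (cases "i = 1")
      case True
      with eq show ?thesis by (auto simp: ext_def)
    next
      case False
      with i have i': "i - 1 \<in> {1..k}" "i - 1 < i" by auto
      then have "ext (i - 1) = \<tau> (i - 1)" by (auto simp: ext_def)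
      moreover have "\<tau> (i - 1) < \<tau> i"
        using i i' by (intro mono) auto
      ultimately have "ext (i - 1) \<in> \<tau> ` {1..k}" "ext (i - 1) < \<tau> i"
        using i' by auto
      with eq show ?thesis by auto
    qed
    show q: "ext (Suc i) \<in> \<tau> ` {1..k} \<and> a < ext (Suc i) \<or> 2 \<le> ext (Suc i) + a"
      using eq i by (auto simp: ext_def)
    show "ext (i - 1) \<le> ext (Suc i)"
    proof -
      have "0 \<le> a" using ge0(1) i eq by blast
      with p q a show ?thesis by linarith
    qed
  qed (use eq i in auto)
qed

end

section \<open>Single facilities against the socially optimal locations\<close>

text \<open>Agrees with \<open>soc_opt\<close> on \<open>{1..k}\<close>, but the formula also holds
  at 0 and \<open>Suc k\<close>, where it yields the reflections of the outermost locations
  (\<open>ext_loc\<close>).\<close>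

definition loc :: "nat \<Rightarrow> nat \<Rightarrow> real" where
  "loc k i = (2 * real i - 1) / (2 * real k)"

lemma facilities_soc_opt: "facilities k (soc_opt k) = loc k ` {1..k}"
  by (auto simp: facilities_def soc_opt_def loc_def intro!: image_cong)

lemma loc_Suc: "loc k (Suc i) = loc k i + 1 / real k"
  by (cases "k = 0") (auto simp: loc_def field_simps)

lemma loc_mono: "i \<le> j \<Longrightarrow> loc k i \<le> loc k j"
  by (auto simp: loc_def divide_right_mono)

lemma loc_less: "1 \<le> k \<Longrightarrow> i < j \<Longrightarrow> loc k i < loc k j"
  by (auto simp: loc_def divide_strict_right_mono)

lemma loc_ends:
  assumes "1 \<le> k"
  shows "loc k 0 = - 1 / (2 * real k)" "loc k 1 = 1 / (2 * real k)" "loc k k = 1 - 1 / (2 * real k)"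
  using assms by (auto simp: loc_def field_simps)

lemma loc_mem: "i \<in> {1..k} \<Longrightarrow> loc k i \<in> {0..1}"
  by (auto simp: loc_def field_simps)

lemma locations_loc: "1 \<le> k \<Longrightarrow> locations k (loc k)"
  by unfold_locales (use loc_mem in \<open>auto simp: strict_mono_on_def loc_less\<close>)

lemma ext_loc: "1 \<le> k \<Longrightarrow> i \<le> Suc k \<Longrightarrow> locations.ext k (loc k) i = loc k i"
  by (auto simp: locations.ext_def[OF locations_loc] loc_def field_simps)

text \<open>All gaps, the reflected ones included, have length 1 / k. So half of one gap, or a
  quarter of two adjacent gaps, is 1 / (2k). Outside the outermost locations the bounds for the end
  gaps are strictly smaller.\<close>

lemma gain_soc_opt_le:
  assumes "1 \<le> k" "a \<in> {0..1}"
  shows "gain {a} (loc k ` {1..k}) \<le> 1 / (2 * real k)"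
    and "a < loc k 1 \<or> loc k k < a \<Longrightarrow> gain {a} (loc k ` {1..k}) < 1 / (2 * real k)"
proof -
  interpret locations k "loc k" by (rule locations_loc) fact
  show "gain {a} (loc k ` {1..k}) \<le> 1 / (2 * real k)"
  proof (rule slot_exists[OF assms(1), of a "loc k"])
    assume "a < loc k 1"
    then show ?thesis
      using gain_first_gap[of a] assms loc_ends(2)[OF assms(1)] by auto
  next
    fix i assume i: "i \<in> {1..k}" "loc k i \<le> a" "i < k \<Longrightarrow> a < loc k (Suc i)"
    show ?thesis
    proof (cases "loc k i = a")
      case True
      have "loc k (Suc i) - loc k (i - 1) = 2 / real k"
        using i loc_Suc[of k i] loc_Suc[of k "i - 1"] by (auto simp: field_simps)
      then show ?thesis
        using gain_at_location[OF i(1,3) _ True] assms i by (auto simp: ext_loc)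
    next
      case False
      with i have less: "loc k i < a" by simp
      have "loc k (Suc i) - loc k i = 1 / real k"
        using loc_Suc[of k i] by simp
      then show ?thesis
        using gain_gap[OF i(1,3) _ less] assms i by (auto simp: ext_loc)
    qed
  qed
  assume "a < loc k 1 \<or> loc k k < a"
  then show "gain {a} (loc k ` {1..k}) < 1 / (2 * real k)"
  proof
    assume "a < loc k 1"
    then show ?thesis
      using gain_first_gap[of a] assms loc_ends(2)[OF assms(1)] by auto
  next
    assume less: "loc k k < a"
    then show ?thesis
      using gain_last_gap[of k a] assms loc_ends(3)[OF assms(1)] by auto
  qed
qed

section \<open>The socially optimal locations\<close>

text \<open>From the midpoint of \<open>loc k i\<close> and \<open>b\<close> up to the midpoint of
  \<open>a\<close> and \<open>loc k (Suc i)\<close>, customers find both \<open>a\<close> and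
  \<open>b\<close> at least as near as any opposing location. This interval is nondegenerate because
  \<open>b - a\<close> is less than the slot length.\<close>

lemma gain_soc_opt_pair_less:
  assumes "i \<in> {1..<k}" "loc k i \<le> a" "a < b" "b \<le> loc k (Suc i)" "b - a < 1 / real k"
  shows "gain {a, b} (loc k ` {1..k}) < gain {a} (loc k ` {1..k}) + gain {b} (loc k ` {1..k})"
proof (rule gain_pair_overlap)
  have "loc k i \<in> {0..1}" "loc k (Suc i) \<in> {0..1}"
    using loc_mem[of i k] loc_mem[of "Suc i" k] assms(1) by auto
  then show "{(loc k i + b) / 2..(a + loc k (Suc i)) / 2} \<subseteq> {0..1}"
    using assms by auto
  show "(loc k i + b) / 2 < (a + loc k (Suc i)) / 2"
    using assms loc_Suc[of k i] by auto
  fix t g assume t: "t \<in> {(loc k i + b) / 2..(a + loc k (Suc i)) / 2}" and "g \<in> loc k ` {1..k}"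
  then obtain m where m: "g = loc k m" by auto
  have "g \<le> loc k i \<or> loc k (Suc i) \<le> g"
    using loc_mono[of m i k] loc_mono[of "Suc i" m k] m by (cases "m \<le> i") auto
  then show "\<bar>t - a\<bar> \<le> \<bar>t - g\<bar> \<and> \<bar>t - b\<bar> \<le> \<bar>t - g\<bar>"
    using t assms(2-4) by (auto split: abs_split)
qed (use assms in auto)

text \<open>If \<open>F\<close> earns one half against the socially optimal locations, then after rescaling these to
  \<open>0, \<dots>, k - 1\<close>, both floor and ceiling are injective on \<open>F\<close>, and hence have the same sum.\<close>

lemma gain_soc_opt_less_half:
  assumes k: "1 \<le> k" and F: "finite F" "F \<subseteq> {0..1}" "card F = k" "F \<noteq> loc k ` {1..k}"
  shows "gain F (loc k ` {1..k}) < 1 / 2"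
proof (rule ccontr)
  let ?G = "loc k ` {1..k}"
  assume not_less: "\<not> gain F ?G < 1 / 2"
  have total: "(\<Sum>a\<in>F. 1 / (2 * real k)) = 1 / 2"
    using F(3) k by simp
  \<comment> \<open>The individual bounds add up to exactly 1/2, so no facility may fall short of
    its own bound.\<close>
  have inside: "loc k 1 \<le> a \<and> a \<le> loc k k" if "a \<in> F" for a
  proof (rule ccontr)
    assume "\<not> ?thesis"
    then have "gain {a} ?G < 1 / (2 * real k)"
      using gain_soc_opt_le(2)[OF k, of a] F(2) that by auto
    then have "(\<Sum>a\<in>F. gain {a} ?G) < (\<Sum>a\<in>F. 1 / (2 * real k))"
      using F(1,2) that gain_soc_opt_le(1)[OF k] by (intro sum_strict_mono_ex1) auto
    then show False
      using gain_subadditive[OF F(1), of ?G] total not_less by auto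
  qed
  \<comment> \<open>Double counting of customers would likewise bring the total below 1/2.\<close>
  have separated: "1 / real k \<le> b - a"
    if i: "i \<in> {1..<k}" and ab: "a \<in> F" "b \<in> F" "loc k i \<le> a" "a < b" "b \<le> loc k (Suc i)" for a b i
  proof (rule ccontr)
    assume "\<not> ?thesis"
    then have "gain {a, b} ?G < gain {a} ?G + gain {b} ?G"
      using i ab by (intro gain_soc_opt_pair_less) auto
    moreover have "gain F ?G \<le> gain {a, b} ?G + gain (F - {a, b}) ?G"
      using gain_Un_le[of "{a, b}" "F - {a, b}" ?G] F(1) ab by (simp add: insert_absorb)
    moreover have "gain (F - {a, b}) ?G \<le> (\<Sum>a\<in>F - {a, b}. gain {a} ?G)"
      using F(1) by (intro gain_subadditive) auto
    moreover have "(\<Sum>a\<in>F. gain {a} ?G) = (\<Sum>a\<in>F - {a, b}. gain {a} ?G) + (\<Sum>a\<in>{a, b}. gain {a} ?G)"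
      using F(1) ab by (intro sum.subset_diff) auto
    moreover have "(\<Sum>a\<in>F. gain {a} ?G) \<le> (\<Sum>a\<in>F. 1 / (2 * real k))"
      using F(2) gain_soc_opt_le(1)[OF k] by (intro sum_mono) auto
    ultimately show False
      using total not_less ab by simp
  qed
  \<comment> \<open>Rescaled so that \<open>loc k (Suc m)\<close> has the integer value
    \<open>m\<close>.\<close>
  define y where "y a = a * real k - 1 / 2" for a
  have y_less: "y a < y b \<longleftrightarrow> a < b" for a b
    using k by (simp add: y_def)
  have loc_le: "loc k (nat m + 1) \<le> a \<longleftrightarrow> real_of_int m \<le> y a"
       and le_loc: "a \<le> loc k (nat m + 1) \<longleftrightarrow> y a \<le> real_of_int m" if "0 \<le> m" for a m
    using that k by (auto simp: loc_def y_def field_simps)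
  have y_range: "0 \<le> y a" "y a \<le> real k - 1" if "a \<in> F" for a
    using inside[OF that] k by (auto simp: loc_def y_def field_simps)
  have gap: "b - a < 1 / real k \<longleftrightarrow> y b - y a < 1" for a b
  proof -
    have "y b - y a = (b - a) * real k" by (simp add: y_def algebra_simps)
    then show ?thesis using k by (simp add: pos_less_divide_eq)
  qed
  \<comment> \<open>This is \<open>separated\<close> in the rescaled coordinates. Equal floors or
    equal ceilings confine two points to a half-open unit interval, where they are less than 1
    apart.\<close>
  have no_pair: False if "a \<in> F" "b \<in> F" "a < b" "real_of_int m \<le> y a" "y b \<le> real_of_int m + 1" "y b - y a < 1" for a b m
  proof -
    have m: "-1 < m" "m < int k - 1"
      using y_range(1)[OF that(1)] y_range(1)[OF that(2)] y_range(2)[OF that(2)] that y_less[of a b] by linarith+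
    have "1 / real k \<le> b - a"
    proof (rule separated[of "nat m + 1"])
      show "b \<le> loc k (Suc (nat m + 1))"
        using le_loc[of "m + 1" b] m that by (simp add: nat_add_distrib)
      show "loc k (nat m + 1) \<le> a"
        using loc_le[of m a] m that by simp
    qed (use m that in auto)
    then show False using gap[of b a] that by linarith
  qed
  have inj: "inj_on (\<lambda>a. \<lfloor>y a\<rfloor>) F" "inj_on (\<lambda>a. \<lceil>y a\<rceil>) F"
  proof (safe intro!: linorder_inj_onI')
    fix a b assume ab: "a \<in> F" "b \<in> F" "a < b"
    show False if eq: "\<lfloor>y a\<rfloor> = \<lfloor>y b\<rfloor>"
    proof (rule no_pair[OF ab])
      show "real_of_int \<lfloor>y a\<rfloor> \<le> y a" "y b \<le> real_of_int \<lfloor>y a\<rfloor> + 1" "y b - y a < 1"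
        using floor_correct[of "y a"] floor_correct[of "y b"] eq by linarith+
    qed
    show False if eq: "\<lceil>y a\<rceil> = \<lceil>y b\<rceil>"
    proof (rule no_pair[OF ab])
      show "real_of_int (\<lceil>y b\<rceil> - 1) \<le> y a" "y b \<le> real_of_int (\<lceil>y b\<rceil> - 1) + 1" "y b - y a < 1"
        using ceiling_correct[of "y a"] ceiling_correct[of "y b"] eq by linarith+
    qed
  qed
  have "\<lfloor>y a\<rfloor> \<in> {0..int k - 1}" "\<lceil>y a\<rceil> \<in> {0..int k - 1}" if "a \<in> F" for a
    using y_range[OF that] unfolding atLeastAtMost_iff by linarith+
  then have "(\<lambda>a. \<lfloor>y a\<rfloor>) ` F \<subseteq> {0..int k - 1}" "(\<lambda>a. \<lceil>y a\<rceil>) ` F \<subseteq> {0..int k - 1}"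
    by blast+
  \<comment> \<open>Each image consists of \<open>k\<close> distinct integers in a range of
    \<open>k\<close> integers, so it fills the range.\<close>
  then have "(\<lambda>a. \<lfloor>y a\<rfloor>) ` F = {0..int k - 1}" "(\<lambda>a. \<lceil>y a\<rceil>) ` F = {0..int k - 1}"
    using F(3) inj by (simp_all add: card_subset_eq card_image)
  then have "(\<Sum>a\<in>F. \<lfloor>y a\<rfloor>) = (\<Sum>a\<in>F. \<lceil>y a\<rceil>)"
    using sum.reindex[OF inj(1), of id] sum.reindex[OF inj(2), of id]
    by (simp add: o_def)
  then have "(\<Sum>a\<in>F. \<lceil>y a\<rceil> - \<lfloor>y a\<rfloor>) = 0"
    by (simp add: sum_subtractf)
  \<comment> \<open>The ceiling is never below the floor, so equal sums force every
    \<open>y a\<close> to be an integer.\<close>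
  then have eq: "\<lceil>y a\<rceil> = \<lfloor>y a\<rfloor>" if "a \<in> F" for a
    using that F(1) floor_le_ceiling by (subst (asm) sum_nonneg_eq_0_iff) auto
  have "F \<subseteq> ?G"
  proof
    fix a assume a: "a \<in> F"
    then have y: "y a = real_of_int \<lfloor>y a\<rfloor>" "0 \<le> \<lfloor>y a\<rfloor>" "\<lfloor>y a\<rfloor> \<le> int k - 1"
      using eq[OF a] y_range[OF a] by linarith+
    then have "a = loc k (nat \<lfloor>y a\<rfloor> + 1)"
      using loc_le[of "\<lfloor>y a\<rfloor>" a] le_loc[of "\<lfloor>y a\<rfloor>" a] by linarith
    then show "a \<in> ?G"
      using y by (intro image_eqI[of _ _ "nat \<lfloor>y a\<rfloor> + 1"]) auto
  qed
  moreover have "card ?G \<le> k"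
    using card_image_le[of "{1..k}" "loc k"] by simp
  ultimately have "F = ?G"
    using F(3) by (metis card_seteq finite_atLeastAtMost finite_imageI)
  with F(4) show False ..
qed

lemma gain_soc_opt_le_half:
  assumes k: "1 \<le> k" and F: "finite F" "F \<subseteq> {0..1}"
  shows "gain F (loc k ` {1..k}) \<le> real (card F) / (2 * real k)"
proof -
  have "gain F (loc k ` {1..k}) \<le> (\<Sum>a\<in>F. gain {a} (loc k ` {1..k}))"
    using F(1) by (intro gain_subadditive) auto
  also have "\<dots> \<le> (\<Sum>a\<in>F. 1 / (2 * real k))"
    using F(2) gain_soc_opt_le(1)[OF k] by (intro sum_mono) auto
  finally show ?thesis by simp
qed

section \<open>Lower bounds from the cells around the socially optimal locations\<close>

text \<open>Half-open, so that distinct cells are disjoint; the customer 1 is left uncovered, which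
  is harmless for integrals.\<close>

definition cell :: "nat \<Rightarrow> nat \<Rightarrow> real set" where
  "cell k j = {(real j - 1) / real k..<real j / real k}"

definition cell_gain :: "nat \<Rightarrow> nat \<Rightarrow> real set \<Rightarrow> real" where
  "cell_gain k j G = (LBINT t:cell k j. share {loc k j} G t)"

lemma cell_disjoint: "t \<in> cell k i \<Longrightarrow> t \<in> cell k j \<Longrightarrow> i = j"
proof (rule ccontr)
  assume "t \<in> cell k i" "t \<in> cell k j" "i \<noteq> j"
  then have t: "real i - 1 \<le> t * real k" "t * real k < real i" "real j - 1 \<le> t * real k" "t * real k < real j"
    by (cases "k = 0"; auto simp: cell_def field_simps)+
  then have "real i < real j + 1" "real j < real i + 1" by linarith+
  with \<open>i \<noteq> j\<close> show False by linarith
qed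

lemma cell_subset: "j \<in> {1..k} \<Longrightarrow> cell k j \<subseteq> {0..1}"
proof
  fix t assume j: "j \<in> {1..k}" and t: "t \<in> cell k j"
  have "0 \<le> (real j - 1) / real k" "real j / real k \<le> 1"
    using j by auto
  with t show "t \<in> {0..1}" unfolding cell_def atLeastLessThan_iff atLeastAtMost_iff by linarith
qed

lemma cell_cover:
  assumes "1 \<le> k" "0 \<le> t" "t < 1"
  obtains j where "j \<in> {1..k}" "t \<in> cell k j"
proof
  have "0 \<le> t * real k" "t * real k < real k" using assms by auto
  then show "nat \<lfloor>t * real k\<rfloor> + 1 \<in> {1..k}"
    by (auto simp: nat_less_iff floor_less_iff Suc_le_eq)
  have "0 \<le> \<lfloor>t * real k\<rfloor>" using assms by simp
  then have "real (nat \<lfloor>t * real k\<rfloor>) = of_int \<lfloor>t * real k\<rfloor>" by simp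
  then show "t \<in> cell k (nat \<lfloor>t * real k\<rfloor> + 1)"
    using assms(1) floor_correct[of "t * real k"] by (auto simp: cell_def field_simps)
qed

lemma cell_nearest:
  assumes "t \<in> cell k j"
  shows "\<bar>t - loc k j\<bar> \<le> \<bar>t - loc k i\<bar>"
proof (cases "k = 0 \<or> i = j")
  case False
  then have t: "real j - 1 \<le> t * real k" "t * real k < real j" and ij: "real i + 1 \<le> real j \<or> real j + 1 \<le> real i"
    using assms by (auto simp: cell_def field_simps)
  have "\<bar>t - loc k m\<bar> = \<bar>t * real k - (real m - 1 / 2)\<bar> / real k" for m
  proof -
    have "t - loc k m = (t * real k - (real m - 1 / 2)) / real k"
      using False by (auto simp: loc_def field_simps)
    then show ?thesis by (simp add: abs_divide)
  qed
  moreover have "\<bar>t * real k - (real j - 1 / 2)\<bar> \<le> \<bar>t * real k - (real i - 1 / 2)\<bar>"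
    using t ij by linarith
  ultimately show ?thesis by (simp add: divide_right_mono)
qed (auto simp: loc_def)

lemma cell_integrable:
  assumes "finite G"
  shows "integrable lborel (\<lambda>t. indicator (cell k j) t * share {loc k j} G t)"
proof -
  have "set_integrable lborel (cell k j) (share {loc k j} G)"
    by (rule set_integrable_subset[OF set_integrable_share[of _ _ "(real j - 1) / real k" "real j / real k"]])
       (use assms in \<open>auto simp: cell_def\<close>)
  then show ?thesis by (simp add: set_integrable_def)
qed

lemma share_mono: "F \<subseteq> F' \<Longrightarrow> share F G t \<le> share F' G t"
  by (auto simp: share_def)

lemma share_le_nearest:
  assumes "\<And>f. f \<in> F \<Longrightarrow> \<bar>t - a\<bar> \<le> \<bar>t - f\<bar>"
  shows "share F G t \<le> share {a} G t"
proof -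
  have "\<forall>g\<in>G. \<bar>t - a\<bar> < \<bar>t - g\<bar>" if "\<exists>f\<in>F. \<forall>g\<in>G. \<bar>t - f\<bar> < \<bar>t - g\<bar>"
    using that assms le_less_trans by blast
  moreover have "\<forall>g\<in>G. \<bar>t - a\<bar> \<le> \<bar>t - g\<bar>" if "\<exists>f\<in>F. \<forall>g\<in>G. \<bar>t - f\<bar> \<le> \<bar>t - g\<bar>"
    using that assms order_trans by blast
  ultimately show ?thesis by (simp add: share_def)
qed

text \<open>By disjointness at most one summand is nonzero at a given customer, and it is dominated
  by the share of the larger set \<open>F\<close>. This is what occupying the locations with indices
  in \<open>J\<close> secures.\<close>

lemma sum_cell_gain_le:
  assumes "finite F" "finite G" "J \<subseteq> {1..k}" "loc k ` J \<subseteq> F"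
  shows "(\<Sum>j\<in>J. cell_gain k j G) \<le> gain F G"
proof -
  have "finite J" using assms(3) by (rule finite_subset) auto
  have "(\<Sum>j\<in>J. indicator (cell k j) t * share {loc k j} G t) \<le> indicator {0..1} t * share F G t" for t
  proof (cases "\<exists>j\<in>J. t \<in> cell k j")
    case False
    then have "(\<Sum>j\<in>J. indicator (cell k j) t * share {loc k j} G t) = 0"
      by (intro sum.neutral) auto
    then show ?thesis by (simp add: share_bounds)
  next
    case True
    then obtain j where j: "j \<in> J" "t \<in> cell k j" by auto
    then have "(\<Sum>i\<in>J. indicator (cell k i) t * share {loc k i} G t) = (\<Sum>i\<in>{j}. indicator (cell k i) t * share {loc k i} G t)"
    proof (intro sum.mono_neutral_right ballI)
      fix i assume "i \<in> J - {j}"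
      then have "t \<notin> cell k i" using cell_disjoint[OF _ j(2)] by blast
      then show "indicator (cell k i) t * share {loc k i} G t = 0" by simp
    qed (use \<open>finite J\<close> j in auto)
    also have "\<dots> \<le> indicator {0..1} t * share F G t"
    proof -
      have "t \<in> {0..1}" using j assms(3) cell_subset by blast
      moreover have "share {loc k j} G t \<le> share F G t"
        using j assms(4) by (intro share_mono) auto
      ultimately show ?thesis using j by simp
    qed
    finally show ?thesis .
  qed
  moreover have "integrable lborel (\<lambda>t. indicator {0..1} t * share F G t)"
    using set_integrable_share[OF assms(1,2), of 0 1] by (simp add: set_integrable_def)
  ultimately have "(\<integral>t. (\<Sum>j\<in>J. indicator (cell k j) t * share {loc k j} G t) \<partial>lborel) \<le> (\<integral>t. indicator {0..1} t * share F G t \<partial>lborel)"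
    by (intro integral_mono Bochner_Integration.integrable_sum cell_integrable assms(2))
  then show ?thesis
    by (simp add: Bochner_Integration.integral_sum cell_integrable assms(2) cell_gain_def gain_def set_lebesgue_integral_def)
qed

text \<open>In its own cell \<open>loc k j\<close> is the nearest of all the optimal locations, so
  the others add nothing there. The only customer in no cell is 1, a null set.\<close>

lemma gain_soc_opt_le_sum_cell_gain:
  assumes "1 \<le> k" "finite G"
  shows "gain (loc k ` {1..k}) G \<le> (\<Sum>j=1..k. cell_gain k j G)"
proof -
  have "indicator {0..1} t * share (loc k ` {1..k}) G t \<le> (\<Sum>j=1..k. indicator (cell k j) t * share {loc k j} G t)"
    if "t \<noteq> 1" for t
  proof (cases "t \<in> {0..1}")
    case False then show ?thesis by (simp add: sum_nonneg share_bounds)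
  next
    case True
    with that obtain j where j: "j \<in> {1..k}" "t \<in> cell k j"
      using cell_cover[OF assms(1), of t] by auto
    have "share (loc k ` {1..k}) G t \<le> share {loc k j} G t"
      using cell_nearest[OF j(2)] by (intro share_le_nearest) auto
    also have "\<dots> = (\<Sum>i\<in>{j}. indicator (cell k i) t * share {loc k i} G t)"
      using j by simp
    also have "\<dots> \<le> (\<Sum>i=1..k. indicator (cell k i) t * share {loc k i} G t)"
      by (rule sum_mono2) (use j in \<open>auto simp: share_bounds\<close>)
    finally show ?thesis using True by simp
  qed
  moreover have "integrable lborel (\<lambda>t. indicator {0..1} t * share (loc k ` {1..k}) G t)"
    using set_integrable_share[of "loc k ` {1..k}" G 0 1] assms(2) by (simp add: set_integrable_def)
  moreover have "AE t in lborel. t \<noteq> (1 :: real)" by (rule AE_lborel_singleton)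
  ultimately have "(\<integral>t. indicator {0..1} t * share (loc k ` {1..k}) G t \<partial>lborel) \<le> (\<integral>t. (\<Sum>j=1..k. indicator (cell k j) t * share {loc k j} G t) \<partial>lborel)"
    by (intro integral_mono_AE Bochner_Integration.integrable_sum cell_integrable assms(2)) auto
  then show ?thesis
    unfolding Bochner_Integration.integral_sum[OF cell_integrable[OF assms(2)]]
    by (simp add: cell_gain_def gain_def set_lebesgue_integral_def)
qed

lemma cell_gain_bounds:
  assumes "finite G" "j \<in> {1..k}"
  shows "0 \<le> cell_gain k j G" "cell_gain k j G \<le> 1"
proof -
  show "0 \<le> cell_gain k j G"
    unfolding cell_gain_def set_lebesgue_integral_def
    by (rule integral_nonneg_AE) (auto simp: share_bounds)
  have "cell_gain k j G \<le> gain {loc k j} G"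
    using sum_cell_gain_le[of "{loc k j}" G "{j}" k] assms by simp
  also have "\<dots> \<le> 1"
    using gain_bounds(2)[of "{loc k j}" G] assms by simp
  finally show "cell_gain k j G \<le> 1" .
qed

section \<open>A perturbation of the socially optimal locations\<close>

text \<open>Moving the \<open>(j+1)\<close>-st location left by \<open>\<delta>\<close> and the others by a negligible \<open>\<epsilon>\<close> shrinks the gap
  that contains \<open>loc k j\<close> and enlarges the one that contains \<open>loc k (j+1)\<close>.\<close>

definition shifted :: "nat \<Rightarrow> nat \<Rightarrow> real \<Rightarrow> real \<Rightarrow> nat \<Rightarrow> real" where
  "shifted k j \<epsilon> \<delta> i = loc k i - (if i = Suc j then \<delta> else \<epsilon>)"

lemma locations_shifted:
  assumes "1 \<le> j" "j < k" "0 < \<epsilon>" "\<epsilon> < \<delta>" "\<delta> < 1 / (2 * real k)"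
  shows "locations k (shifted k j \<epsilon> \<delta>)"
proof unfold_locales
  have s: "shifted k j \<epsilon> \<delta> i < loc k i" "loc k i - \<delta> \<le> shifted k j \<epsilon> \<delta> i" for i
    using assms by (auto simp: shifted_def)
  show "1 \<le> k" using assms by simp
  show "strict_mono_on {1..k} (shifted k j \<epsilon> \<delta>)"
  proof (rule strict_mono_onI)
    fix i m :: nat assume "i < m"
    then have "loc k i + 1 / real k \<le> loc k m"
      using loc_mono[of "Suc i" m k] loc_Suc[of k i] by simp
    moreover have "1 / real k = 1 / (2 * real k) + 1 / (2 * real k)"
      by (simp add: field_simps)
    ultimately show "shifted k j \<epsilon> \<delta> i < shifted k j \<epsilon> \<delta> m"
      using s(1)[of i] s(2)[of m] assms by linarith
  qed
  show "shifted k j \<epsilon> \<delta> ` {1..k} \<subseteq> {0..1}"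
  proof safe
    fix i assume i: "i \<in> {1..k}"
    then have "loc k 1 \<le> loc k i" by (intro loc_mono) auto
    then show "shifted k j \<epsilon> \<delta> i \<in> {0..1}"
      using s[of i] loc_mem[OF i] loc_ends(2)[of k] assms by auto
  qed
qed

text \<open>Half of a gap changes by \<open>\<delta> / 2\<close> when its length changes by
  \<open>\<delta>\<close>. The shift by \<open>\<epsilon>\<close> keeps each \<open>loc k i\<close>
  off the opposing locations, so a facility there is not in the sharing case. The weight 2 just left
  of \<open>loc k (Suc j)\<close> covers \<open>Suc j = k\<close>, where the reflected location
  moves right by \<open>\<delta>\<close> too; from \<open>loc k k\<close> on,
  \<open>gain_last_gap\<close> restores the increment \<open>\<delta> / 2\<close>.\<close>

lemma gain_shifted_le:
  assumes jk: "1 \<le> j" "j < k" and eps: "0 < \<epsilon>" "\<epsilon> < \<delta>" "\<delta> < 1 / (2 * real k)" and a: "a \<in> {0..1}"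
  shows "gain {a} (shifted k j \<epsilon> \<delta> ` {1..k}) \<le> 1 / (2 * real k) + \<epsilon> + \<delta> / 2 *
    (indicator {loc k (Suc j)..<loc k (Suc (Suc j))} a - indicator {loc k j..<loc k (Suc j) - \<delta>} a
      + 2 * indicator {loc k (Suc j) - \<delta>..<loc k (Suc j)} a)"
    (is "_ \<le> 1 / (2 * real k) + \<epsilon> + \<delta> / 2 * ?ind")
proof -
  let ?\<tau> = "shifted k j \<epsilon> \<delta>"
  define h where "h = 1 / (2 * real k)"
  have k: "1 \<le> k" using jk by simp
  interpret locations k ?\<tau> by (rule locations_shifted) fact+
  have Suc: "loc k (Suc i) = loc k i + 2 * h" for i
    using loc_Suc by (simp add: h_def)
  have pred: "loc k (i - 1) = loc k i - 2 * h" if "1 \<le> i" for i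
    using Suc[of "i - 1"] that by simp
  have ends: "loc k 0 = - h" "loc k 1 = h" "loc k k = 1 - h"
    using loc_ends[OF k] by (auto simp: h_def)
  have eps': "0 < \<delta>" "\<delta> < h" using eps by (auto simp: h_def)
  have ext0: "ext 0 = loc k 0 + \<epsilon>" and extk: "ext (Suc k) = 2 - ?\<tau> k"
    using jk ends by (auto simp: ext_def shifted_def)
  have ext: "ext i = ?\<tau> i" if "i \<in> {1..k}" for i
    using that by (auto simp: ext_def)
  have \<tau>j: "?\<tau> (Suc j) = loc k (Suc j) - \<delta>"
    by (simp add: shifted_def)
  have \<tau>: "?\<tau> i = loc k i - \<epsilon>" if "i \<noteq> Suc j" for i
    using that by (auto simp: shifted_def)
  have ext_ge: "ext i \<ge> loc k i - \<epsilon>" if "i < Suc j" for i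
    using that jk ext0 ext[of i] \<tau>[of i] eps by (cases "i = 0") auto
  have ind: "?ind = (if loc k (Suc j) \<le> a \<and> a < loc k (Suc j) + 2 * h then 1
       else if loc k (Suc j) - \<delta> \<le> a \<and> a < loc k (Suc j) then 2
       else if loc k (Suc j) - 2 * h \<le> a \<and> a < loc k (Suc j) - \<delta> then - 1 else 0)"
    using eps' by (auto simp: indicator_def Suc)
  show ?thesis
    unfolding h_def[symmetric]
  proof (rule slot_exists[OF k, of a ?\<tau>])
    assume a1: "a < ?\<tau> 1"
    have \<tau>1: "?\<tau> 1 = h - \<epsilon>" using jk ends by (auto simp: shifted_def)
    have "loc k 1 \<le> loc k j" using jk by (intro loc_mono) auto
    then have "?ind = 0"
      using a1 \<tau>1 ends eps eps' unfolding ind by (auto simp: Suc)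
    then show "gain {a} (?\<tau> ` {1..k}) \<le> h + \<epsilon> + \<delta> / 2 * ?ind"
      using gain_first_gap[OF _ a1] a a1 \<tau>1 eps by auto
  next
    fix i assume i: "i \<in> {1..k}" "?\<tau> i \<le> a" "i < k \<Longrightarrow> a < ?\<tau> (Suc i)"
    consider (low) "i < j" | (left) "i = j" | (right) "i = Suc j" "i < k" | (last) "i = Suc j" "i = k"
      | (high) "Suc j < i"
      using i(1) by (metis atLeastAtMost_iff nat_less_le not_less_eq not_less_iff_gr_or_eq)
    then show "gain {a} (?\<tau> ` {1..k}) \<le> h + \<epsilon> + \<delta> / 2 * ?ind"
    proof cases
      case low
      have "loc k (Suc i) \<le> loc k j" using low by (intro loc_mono) auto
      then have a_less: "a < loc k (Suc j) - 2 * h"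
        using i low jk eps \<tau>[of "Suc i"] by (auto simp: Suc)
      then have "?ind = 0" unfolding ind using eps' by auto
      moreover have "ext (Suc i) = loc k i + 2 * h - \<epsilon>"
        using ext[of "Suc i"] \<tau>[of "Suc i"] low jk by (auto simp: Suc)
      moreover have "ext i = loc k i - \<epsilon>" "?\<tau> i = loc k i - \<epsilon>"
        using ext[of i] \<tau>[of i] low i by auto
      moreover have "ext (i - 1) \<ge> loc k i - 2 * h - \<epsilon>"
        using ext_ge[of "i - 1"] pred[of i] low i by auto
      ultimately show ?thesis
        using gain_gap[of i a] gain_at_location[of i a] i a eps by (cases "?\<tau> i = a") auto
    next
      case left
      have "ext (Suc i) = loc k i + 2 * h - \<delta>"
        using ext[of "Suc i"] \<tau>j left jk by (auto simp: Suc)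
      moreover have "ext i = loc k i - \<epsilon>" "?\<tau> i = loc k i - \<epsilon>"
        using ext[of i] \<tau>[of i] left i by auto
      moreover have "ext (i - 1) \<ge> loc k i - 2 * h - \<epsilon>"
        using ext_ge[of "i - 1"] pred[of i] left i by auto
      moreover have "a < loc k i + 2 * h - \<delta>"
        using i left jk \<tau>j by (auto simp: Suc)
      ultimately show ?thesis
        using gain_gap[of i a] gain_at_location[of i a] i a eps eps' left unfolding ind
        by (cases "?\<tau> i = a") (auto simp: Suc)
    next
      case right
      have "ext (Suc i) = loc k i + 2 * h - \<epsilon>"
        using ext[of "Suc i"] \<tau>[of "Suc i"] right jk by (auto simp: Suc)
      moreover have "ext i = loc k i - \<delta>" "?\<tau> i = loc k i - \<delta>"
        using ext[of i] \<tau>j right i by auto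
      moreover have "ext (i - 1) \<ge> loc k i - 2 * h - \<epsilon>"
        using ext_ge[of "i - 1"] pred[of i] right i by auto
      moreover have "a < loc k i + 2 * h - \<epsilon>"
        using i right jk \<tau>[of "Suc i"] by (auto simp: Suc)
      ultimately show ?thesis
        using gain_gap[of i a] gain_at_location[of i a] i a eps eps' right unfolding ind
        by (cases "?\<tau> i = a") auto
    next
      case last
      have "ext (Suc i) = loc k i + 2 * h + \<delta>"
        using extk \<tau>j last ends by auto
      moreover have "ext i = loc k i - \<delta>" "?\<tau> i = loc k i - \<delta>"
        using ext[of i] \<tau>j last i by auto
      moreover have "ext (i - 1) \<ge> loc k i - 2 * h - \<epsilon>"
        using ext_ge[of "i - 1"] pred[of i] last i by auto
      moreover have "a < loc k i + 2 * h"
        using a last ends eps' by auto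
      ultimately show ?thesis
        using gain_gap[of i a] gain_at_location[of i a] gain_last_gap[of i a] i a eps eps' last ends unfolding ind
        by (cases "?\<tau> i = a") auto
    next
      case high
      have "ext (Suc i) \<le> loc k i + 2 * h + \<epsilon>"
      proof (cases "i = k")
        case True
        then show ?thesis using extk \<tau>[of k] high ends by auto
      next
        case False
        then show ?thesis using ext[of "Suc i"] \<tau>[of "Suc i"] high i eps by (auto simp: Suc)
      qed
      moreover have "ext i = loc k i - \<epsilon>" "?\<tau> i = loc k i - \<epsilon>"
        using ext[of i] \<tau>[of i] high i by auto
      moreover have "loc k (Suc (Suc j)) \<le> loc k i"
        using high by (intro loc_mono) auto
      \<comment> \<open>For \<open>i = Suc (Suc j)\<close> the left neighbour is the location moved
        by \<open>\<delta>\<close>. A facility on location \<open>i\<close> itself still lies left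
        of \<open>loc k i\<close>, where the weight is 1.\<close>
      moreover have "ext (i - 1) \<ge> loc k i - 2 * h - (if i = Suc (Suc j) then \<delta> else \<epsilon>)"
        using ext[of "i - 1"] \<tau>[of "i - 1"] \<tau>j high i by (cases i) (auto simp: Suc)
      ultimately show ?thesis
        using gain_gap[of i a] gain_at_location[of i a] i a eps eps' high unfolding ind
        by (cases "?\<tau> i = a"; cases "i = Suc (Suc j)") (auto simp: Suc)
    qed
  qed
qed

section \<open>Optimal expected numbers of facilities\<close>

text \<open>Joint measurability in outcome and customer makes the integral over customers measurable
  in the outcome. It becomes automatic once the quantifiers range over the fixed finite index sets
  instead of the random images.\<close>

lemma measurable_share_pair:
  fixes A :: "'i \<Rightarrow> 'a \<Rightarrow> real" and B :: "'j \<Rightarrow> 'a \<Rightarrow> real"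
  assumes [measurable]: "finite I" "finite J"
    and [measurable]: "\<And>i. i \<in> I \<Longrightarrow> A i \<in> borel_measurable N" "\<And>j. j \<in> J \<Longrightarrow> B j \<in> borel_measurable N"
  shows "(\<lambda>(\<omega>, t). share ((\<lambda>i. A i \<omega>) ` I) ((\<lambda>j. B j \<omega>) ` J) t) \<in> borel_measurable (N \<Otimes>\<^sub>M lborel)"
proof -
  have "(\<lambda>(\<omega>, t). share ((\<lambda>i. A i \<omega>) ` I) ((\<lambda>j. B j \<omega>) ` J) t) =
    (\<lambda>(\<omega>, t). if \<exists>i\<in>I. \<forall>j\<in>J. \<bar>t - A i \<omega>\<bar> < \<bar>t - B j \<omega>\<bar> then 1
      else if \<exists>i\<in>I. \<forall>j\<in>J. \<bar>t - A i \<omega>\<bar> \<le> \<bar>t - B j \<omega>\<bar> then 1/2 else 0)"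
    by (simp add: share_def cong: if_cong)
  also have "\<dots> \<in> borel_measurable (N \<Otimes>\<^sub>M lborel)"
    by measurable
  finally show ?thesis .
qed

lemma measurable_gain:
  fixes A :: "'i \<Rightarrow> 'a \<Rightarrow> real" and B :: "'j \<Rightarrow> 'a \<Rightarrow> real"
  assumes "finite I" "finite J"
    and "\<And>i. i \<in> I \<Longrightarrow> A i \<in> borel_measurable N" "\<And>j. j \<in> J \<Longrightarrow> B j \<in> borel_measurable N"
  shows "(\<lambda>\<omega>. gain ((\<lambda>i. A i \<omega>) ` I) ((\<lambda>j. B j \<omega>) ` J)) \<in> borel_measurable N"
proof -
  note [measurable] = measurable_share_pair[OF assms]
  show ?thesis
    unfolding gain_def set_lebesgue_integral_def by measurable
qed

lemma measurable_cell_gain: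
  fixes B :: "'j \<Rightarrow> 'a \<Rightarrow> real"
  assumes "finite J" "\<And>j. j \<in> J \<Longrightarrow> B j \<in> borel_measurable N"
  shows "(\<lambda>\<omega>. cell_gain k m ((\<lambda>j. B j \<omega>) ` J)) \<in> borel_measurable N"
proof -
  note [measurable] = measurable_share_pair[of "{()}" J "\<lambda>_ _. loc k m" N B, OF _ assms(1) _ assms(2), simplified]
  show ?thesis
    unfolding cell_gain_def set_lebesgue_integral_def cell_def by measurable
qed

lemma measurable_gain_singleton [measurable]:
  assumes [measurable]: "finite G"
  shows "(\<lambda>a. gain {a} G) \<in> borel_measurable borel"
  using measurable_gain[of "{()}" G "\<lambda>_ a. a" borel "\<lambda>g _. g"] assms by simp

lemma gain_reflect: "gain ((\<lambda>a. 1 - a) ` F) ((\<lambda>a. 1 - a) ` G) = gain F G"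
proof -
  have "share ((\<lambda>a. 1 - a) ` F) ((\<lambda>a. 1 - a) ` G) (1 - t) = share F G t" for t
    by (simp add: share_def abs_minus_commute)
  then have "gain F G = (\<integral>t. indicator {0..1} (1 + (-1) * t) *\<^sub>R share ((\<lambda>a. 1 - a) ` F) ((\<lambda>a. 1 - a) ` G) (1 + (-1) * t) \<partial>lborel)"
    unfolding gain_def set_lebesgue_integral_def
    by (intro Bochner_Integration.integral_cong) (auto simp: indicator_def)
  also have "\<dots> = gain ((\<lambda>a. 1 - a) ` F) ((\<lambda>a. 1 - a) ` G)"
    unfolding gain_def set_lebesgue_integral_def
    by (subst lborel_integral_real_affine[where c = "-1" and t = 1]) auto
  finally show ?thesis ..
qed

text \<open>\<open>X\<close> lists the random facility locations of player 1. The sum of their individual gains only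
  depends on the expected numbers of facilities, unlike the payoff that it dominates.\<close>

locale optimal_facilities = prob_space +
  fixes X :: "nat \<Rightarrow> 'a \<Rightarrow> real" and l k :: nat
  assumes k1: "1 \<le> k"
    and X: "\<And>i. i \<in> {1..l} \<Longrightarrow> random_variable borel (X i)"
    and X_range: "\<And>i \<omega>. i \<in> {1..l} \<Longrightarrow> \<omega> \<in> space M \<Longrightarrow> X i \<omega> \<in> {0..1}"
    and optimal: "\<And>T. finite T \<Longrightarrow> T \<subseteq> {0..1} \<Longrightarrow> card T = k \<Longrightarrow>
      real l / (2 * real k) \<le> expectation (\<lambda>\<omega>. \<Sum>i=1..l. gain {X i \<omega>} T)"
begin

text \<open>The admissible sets \<open>T\<close> are invariant under reflection; this gives every
  bound on right tails a mirrored version.\<close>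

lemma reflected: "optimal_facilities M (\<lambda>i \<omega>. 1 - X i \<omega>) l k"
proof unfold_locales
  fix T :: "real set" assume T: "finite T" "T \<subseteq> {0..1}" "card T = k"
  have "gain {1 - a} T = gain {a} ((\<lambda>a. 1 - a) ` T)" for a
    using gain_reflect[of "{1 - a}" T] by simp
  moreover have "card ((\<lambda>a. 1 - a) ` T) = k"
    using T(3) by (subst card_image) (auto simp: inj_on_def)
  moreover have "(\<lambda>a. 1 - a) ` T \<subseteq> {0..1}"
    using T(2) unfolding image_subset_iff by force
  ultimately show "real l / (2 * real k) \<le> expectation (\<lambda>\<omega>. \<Sum>i=1..l. gain {1 - X i \<omega>} T)"
    using optimal[of "(\<lambda>a. 1 - a) ` T"] T(1) by simp
qed (use k1 X X_range in auto)

text \<open>The integral of \<open>\<phi>\<close> with respect to the measure \<open>\<mu>\<close>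
  of expected facility numbers; \<open>mean (indicator A)\<close> is
  \<open>\<mu>(A)\<close>.\<close>

definition mean :: "(real \<Rightarrow> real) \<Rightarrow> real" where
  "mean \<phi> = expectation (\<lambda>\<omega>. \<Sum>i=1..l. \<phi> (X i \<omega>))"

lemma integrable_mean:
  fixes \<phi> :: "real \<Rightarrow> real"
  assumes [measurable]: "\<phi> \<in> borel_measurable borel" and B: "\<And>a. a \<in> {0..1} \<Longrightarrow> \<bar>\<phi> a\<bar> \<le> B" and i: "i \<in> {1..l}"
  shows "integrable M (\<lambda>\<omega>. \<phi> (X i \<omega>))"
proof (rule integrable_const_bound[where B = B])
  note [measurable] = X[OF i]
  show "(\<lambda>\<omega>. \<phi> (X i \<omega>)) \<in> borel_measurable M" by measurable
  show "AE \<omega> in M. norm (\<phi> (X i \<omega>)) \<le> B"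
    using X_range[OF i] B by (auto intro!: AE_I2)
qed

lemma mean_linear:
  assumes "\<phi> \<in> borel_measurable borel" "\<And>a. a \<in> {0..1} \<Longrightarrow> \<bar>\<phi> a\<bar> \<le> B"
    and "\<psi> \<in> borel_measurable borel" "\<And>a. a \<in> {0..1} \<Longrightarrow> \<bar>\<psi> a\<bar> \<le> C"
  shows "mean (\<lambda>a. \<phi> a + c * \<psi> a) = mean \<phi> + c * mean \<psi>"
proof -
  have "integrable M (\<lambda>\<omega>. \<Sum>i=1..l. \<phi> (X i \<omega>))" "integrable M (\<lambda>\<omega>. \<Sum>i=1..l. \<psi> (X i \<omega>))"
    using integrable_mean[OF assms(1,2)] integrable_mean[OF assms(3,4)] by auto
  then show ?thesis
    by (simp add: mean_def sum.distrib flip: sum_distrib_left)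
qed

lemma mean_mono:
  assumes "\<phi> \<in> borel_measurable borel" "\<And>a. a \<in> {0..1} \<Longrightarrow> \<bar>\<phi> a\<bar> \<le> B"
    and "\<psi> \<in> borel_measurable borel" "\<And>a. a \<in> {0..1} \<Longrightarrow> \<bar>\<psi> a\<bar> \<le> C"
    and "\<And>a. a \<in> {0..1} \<Longrightarrow> \<phi> a \<le> \<psi> a"
  shows "mean \<phi> \<le> mean \<psi>"
  unfolding mean_def
  using integrable_mean[OF assms(1,2)] integrable_mean[OF assms(3,4)] assms(5) X_range
  by (intro integral_mono sum_mono) auto

lemma mean_const: "mean (\<lambda>_. c) = real l * c"
  by (simp add: mean_def prob_space)

lemma optimal_mean:
  assumes "finite T" "T \<subseteq> {0..1}" "card T = k"
  shows "real l / (2 * real k) \<le> mean (\<lambda>a. gain {a} T)"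
  using optimal[OF assms] by (simp add: mean_def)

lemma gain_abs_le: "finite T \<Longrightarrow> \<bar>gain {a} T\<bar> \<le> 1"
  using gain_bounds[of "{a}" T] by simp

text \<open>Take o^k as the test set \<open>T\<close>: each facility earns at most 1 / (2k), yet all
  \<open>l\<close> together earn at least l / (2k) in expectation. So each attains its bound almost
  surely, which \<open>gain_soc_opt_le(2)\<close> excludes outside the outermost locations.\<close>

lemma AE_inside:
  assumes i: "i \<in> {1..l}"
  shows "AE \<omega> in M. loc k 1 \<le> X i \<omega> \<and> X i \<omega> \<le> loc k k"
proof -
  let ?G = "loc k ` {1..k}"
  let ?f = "\<lambda>a. 1 / (2 * real k) - gain {a} ?G"
  have f: "?f \<in> borel_measurable borel" "\<bar>?f a\<bar> \<le> 1" "0 \<le> ?f a" if "a \<in> {0..1}" for a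
  proof -
    show "?f \<in> borel_measurable borel" by measurable
    show "0 \<le> ?f a" using gain_soc_opt_le(1)[OF k1 that] by simp
    moreover have "1 / (2 * real k) \<le> 1" using k1 by simp
    ultimately show "\<bar>?f a\<bar> \<le> 1" using gain_bounds(1)[of "{a}" ?G] by simp
  qed
  have card: "card ?G = k"
    using loc_less[OF k1] by (subst card_image) (auto intro!: linorder_inj_onI simp: less_imp_neq)
  have "mean ?f = mean (\<lambda>_. 1 / (2 * real k)) + (-1) * mean (\<lambda>a. gain {a} ?G)"
    using mean_linear[of "\<lambda>_. 1 / (2 * real k)" "1 / (2 * real k)" "\<lambda>a. gain {a} ?G" 1 "-1"] gain_abs_le by simp
  also have "\<dots> \<le> 0"
    using optimal_mean[OF _ image_subsetI[OF loc_mem] card] by (simp add: mean_const)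
  finally have "mean ?f \<le> 0" .
  moreover have int: "integrable M (\<lambda>\<omega>. ?f (X m \<omega>))" if "m \<in> {1..l}" for m
    by (rule integrable_mean[OF _ _ that, where B = 1]) (use f in auto)
  moreover have "expectation (\<lambda>\<omega>. ?f (X i \<omega>)) \<le> mean ?f"
    unfolding mean_def
  proof (rule integral_mono)
    fix \<omega> assume "\<omega> \<in> space M"
    then show "?f (X i \<omega>) \<le> (\<Sum>i=1..l. ?f (X i \<omega>))"
      using f(3) X_range i by (intro member_le_sum[of i "{1..l}" "\<lambda>i. ?f (X i \<omega>)"]) auto
  qed (use int i in auto)
  moreover have nonneg: "AE \<omega> in M. 0 \<le> ?f (X i \<omega>)"
    using f(3) X_range[OF i] by (intro AE_I2) auto
  ultimately have "expectation (\<lambda>\<omega>. ?f (X i \<omega>)) = 0"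
    using integral_nonneg_AE[OF nonneg] by linarith
  then have "AE \<omega> in M. ?f (X i \<omega>) = 0"
    using integral_nonneg_eq_0_iff_AE[OF int[OF i] nonneg] by simp
  moreover have "AE \<omega> in M. X i \<omega> \<in> {0..1}"
    using X_range[OF i] by (intro AE_I2)
  ultimately show ?thesis
    by eventually_elim (use gain_soc_opt_le(2)[OF k1] in fastforce)
qed

text \<open>Test against \<open>shifted\<close>, cancel the constant l / (2k), divide by
  \<open>\<delta> / 2\<close> and let \<open>\<delta>\<close> tend to 0. In the limit the correction
  interval of length \<open>\<delta>\<close> disappears and the difference of the two slot masses
  remains.\<close>

lemma mean_slot_mono:
  assumes j: "1 \<le> j" "j < k"
  shows "mean (indicator {loc k j..<loc k (Suc j)}) \<le> mean (indicator {loc k (Suc j)..<loc k (Suc (Suc j))})"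
proof -
  \<comment> \<open>The last factor of the denominator starts at 2 to keep \<open>\<delta> n\<close>
    strictly below 1 / (2k), as \<open>gain_shifted_le\<close> requires.\<close>
  define \<delta> where "\<delta> n = 1 / (2 * real k) / real (Suc (Suc n))" for n
  define \<phi> :: "nat \<Rightarrow> real \<Rightarrow> real" where "\<phi> n a = indicator {loc k (Suc j)..<loc k (Suc (Suc j))} a - indicator {loc k j..<loc k (Suc j) - \<delta> n} a
      + 2 * indicator {loc k (Suc j) - \<delta> n..<loc k (Suc j)} a" for n and a :: real
  define \<psi> :: "real \<Rightarrow> real" where "\<psi> a = indicator {loc k (Suc j)..<loc k (Suc (Suc j))} a + (-1) * indicator {loc k j..<loc k (Suc j)} a" for a :: real
  have [measurable]: "\<phi> n \<in> borel_measurable borel" "\<psi> \<in> borel_measurable borel" for n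
    by (simp_all add: \<phi>_def[abs_def] \<psi>_def[abs_def])
  have \<delta>: "0 < \<delta> n" "\<delta> n < 1 / (2 * real k)" "\<delta> n < 1" for n
  proof -
    show "0 < \<delta> n" using k1 by (simp add: \<delta>_def)
    have "1 / (2 * real k) * (1 / real (Suc (Suc n))) < 1 / (2 * real k) * 1"
      by (rule mult_strict_left_mono) (use k1 in auto)
    then show "\<delta> n < 1 / (2 * real k)" by (simp add: \<delta>_def)
    also have "\<dots> \<le> 1" using k1 by simp
    finally show "\<delta> n < 1" .
  qed
  have \<delta>_lim: "\<delta> \<longlonglongrightarrow> 0"
  proof -
    have "(\<lambda>n. 1 / (2 * real k) * (1 / real (Suc (Suc n)))) \<longlonglongrightarrow> 1 / (2 * real k) * 0"
      by (intro tendsto_mult_left LIMSEQ_Suc lim_1_over_n LIMSEQ_Suc[of "\<lambda>n. 1 / real (Suc n)"])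
    then show ?thesis by (simp add: \<delta>_def[abs_def])
  qed
  have \<phi>_bound: "\<bar>\<phi> n a\<bar> \<le> 4" for n a
    by (auto simp: \<phi>_def indicator_def)
  have nonneg: "- (2 * real l * \<delta> n) \<le> mean (\<phi> n)" for n
  proof -
    \<comment> \<open>The negligible shift is the square of \<open>\<delta> n\<close>, so that it
      still vanishes after division by \<open>\<delta> n\<close>.\<close>
    let ?T = "shifted k j ((\<delta> n)\<^sup>2) (\<delta> n) ` {1..k}"
    have eps: "0 < (\<delta> n)\<^sup>2" "(\<delta> n)\<^sup>2 < \<delta> n"
      using \<delta>[of n] by (auto simp: power2_eq_square)
    then interpret S: locations k "shifted k j ((\<delta> n)\<^sup>2) (\<delta> n)"
      using j \<delta> by (intro locations_shifted)
    have "inj_on (shifted k j ((\<delta> n)\<^sup>2) (\<delta> n)) {1..k}"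
      using S.\<tau>(1) by (rule strict_mono_on_imp_inj_on)
    then have "real l / (2 * real k) \<le> mean (\<lambda>a. gain {a} ?T)"
      using S.\<tau>(2) by (intro optimal_mean) (auto simp: card_image)
    also have "\<dots> \<le> mean (\<lambda>a. (1 / (2 * real k) + (\<delta> n)\<^sup>2) + \<delta> n / 2 * \<phi> n a)"
    proof (rule mean_mono[where B = 1 and C = "1 / (2 * real k) + (\<delta> n)\<^sup>2 + \<delta> n / 2 * 4"])
      fix a :: real assume "a \<in> {0..1}"
      then show "gain {a} ?T \<le> (1 / (2 * real k) + (\<delta> n)\<^sup>2) + \<delta> n / 2 * \<phi> n a"
        unfolding \<phi>_def using gain_shifted_le[OF j eps \<delta>(2)] by simp
      have "\<bar>\<delta> n / 2 * \<phi> n a\<bar> \<le> \<delta> n / 2 * 4"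
        using \<phi>_bound[of n a] \<delta>(1)[of n] by (simp add: abs_mult)
      then show "\<bar>(1 / (2 * real k) + (\<delta> n)\<^sup>2) + \<delta> n / 2 * \<phi> n a\<bar> \<le> 1 / (2 * real k) + (\<delta> n)\<^sup>2 + \<delta> n / 2 * 4"
        using eps(1) by (intro order.trans[OF abs_triangle_ineq] add_mono) auto
    qed (auto intro: gain_abs_le)
    also have "\<dots> = real l * (1 / (2 * real k) + (\<delta> n)\<^sup>2) + \<delta> n / 2 * mean (\<phi> n)"
      using mean_linear[of "\<lambda>_. 1 / (2 * real k) + (\<delta> n)\<^sup>2" "1 / (2 * real k) + (\<delta> n)\<^sup>2" "\<phi> n" 4 "\<delta> n / 2"] \<phi>_bound
      by (simp add: mean_const)
    finally have "0 \<le> \<delta> n / 2 * (2 * real l * \<delta> n + mean (\<phi> n))"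
      by (simp add: algebra_simps power2_eq_square)
    then have "0 \<le> 2 * real l * \<delta> n + mean (\<phi> n)"
      using \<delta>(1)[of n] by (simp add: zero_le_mult_iff)
    then show ?thesis by simp
  qed
  have pointwise: "(\<lambda>n. \<phi> n a) \<longlonglongrightarrow> \<psi> a" for a
  proof (rule tendsto_eventually)
    show "eventually (\<lambda>n. \<phi> n a = \<psi> a) sequentially"
    proof (cases "a < loc k (Suc j)")
      case True
      then have "eventually (\<lambda>n. \<delta> n < loc k (Suc j) - a) sequentially"
        using order_tendstoD(2)[OF \<delta>_lim] by simp
      then show ?thesis
        by eventually_elim (use True in \<open>auto simp: \<phi>_def \<psi>_def indicator_def\<close>)
    next
      case False
      then have "\<phi> n a = \<psi> a" for n
        using \<delta>(1)[of n] by (auto simp: \<phi>_def \<psi>_def indicator_def)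
      then show ?thesis by simp
    qed
  qed
  have "(\<lambda>n. mean (\<phi> n)) \<longlonglongrightarrow> mean \<psi>"
    unfolding mean_def
  proof (rule integral_dominated_convergence[where w = "\<lambda>_. real l * 4"])
    note [measurable] = X
    show "(\<lambda>\<omega>. \<Sum>i=1..l. \<psi> (X i \<omega>)) \<in> borel_measurable M"
      "(\<lambda>\<omega>. \<Sum>i=1..l. \<phi> n (X i \<omega>)) \<in> borel_measurable M" for n
      by measurable
    show "AE \<omega> in M. (\<lambda>n. \<Sum>i=1..l. \<phi> n (X i \<omega>)) \<longlonglongrightarrow> (\<Sum>i=1..l. \<psi> (X i \<omega>))"
      by (intro AE_I2 tendsto_sum pointwise)
    have "norm (\<Sum>i=1..l. \<phi> n (X i \<omega>)) \<le> real l * 4" for n \<omega>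
      using sum_norm_bound[of "{1..l}" "\<lambda>i. \<phi> n (X i \<omega>)" 4] \<phi>_bound by simp
    then show "AE \<omega> in M. norm (\<Sum>i=1..l. \<phi> n (X i \<omega>)) \<le> real l * 4" for n
      by simp
  qed simp
  moreover have "(\<lambda>n. - (2 * real l * \<delta> n)) \<longlonglongrightarrow> 0"
    using tendsto_minus[OF tendsto_mult_left[OF \<delta>_lim, of "2 * real l"]] by simp
  ultimately have "0 \<le> mean \<psi>"
    using nonneg by (intro LIMSEQ_le[of "\<lambda>n. - (2 * real l * \<delta> n)" 0 "\<lambda>n. mean (\<phi> n)"]) auto
  also have "mean \<psi> = mean (indicator {loc k (Suc j)..<loc k (Suc (Suc j))}) + (-1) * mean (indicator {loc k j..<loc k (Suc j)})"
    unfolding \<psi>_def by (rule mean_linear[where B = 1 and C = 1]) auto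
  finally show ?thesis by simp
qed

text \<open>The slot masses are nondecreasing and add up to \<open>l\<close>, so the average of the
  last \<open>k + 1 - j\<close> of them is at least the overall average l / k.\<close>

lemma mean_tail:
  assumes j: "j \<in> {1..k}"
  shows "(real k + 1 - real j) * (real l / real k) \<le> mean (indicator {loc k j..})"
proof -
  define m where "m i = mean (indicator {loc k i..<loc k (Suc i)})" for i
  have split: "mean (indicator {loc k i..<loc k n}) = (\<Sum>r=i..<n. m r)" if "i \<le> n" for i n
    using that
  proof (induction n rule: dec_induct)
    case base
    then show ?case by (simp add: mean_const)
  next
    case (step n)
    have "indicator {loc k i..<loc k (Suc n)} = (\<lambda>a. indicator {loc k i..<loc k n} a + 1 * indicator {loc k n..<loc k (Suc n)} a :: real)"
      using loc_mono[OF step(1), of k] loc_mono[of n "Suc n" k] by (auto simp: indicator_def fun_eq_iff)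
    then have "mean (indicator {loc k i..<loc k (Suc n)}) = mean (indicator {loc k i..<loc k n}) + 1 * m n"
      unfolding m_def by (simp only:) (rule mean_linear[where B = 1 and C = 1]; auto)
    then show ?case using step by simp
  qed
  have "m i \<le> m n" if "i \<le> n" "1 \<le> i" "n \<le> k" for i n
    using that(1,3)
  proof (induction n rule: dec_induct)
    case (step n)
    then show ?case
      using mean_slot_mono[of n] that(2) unfolding m_def by linarith
  qed simp
  then have mono: "\<And>i. i \<in> {1..<j} \<Longrightarrow> m i \<le> m j" and mono': "\<And>i. i \<in> {j..<Suc k} \<Longrightarrow> m j \<le> m i"
    using j by auto
  define A B where "A = (\<Sum>i=1..<j. m i)" and "B = (\<Sum>i=j..<Suc k. m i)"
  have A: "A \<le> (real j - 1) * m j"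
    using sum_bounded_above[of "{1..<j}" m "m j"] mono j unfolding A_def by (simp add: of_nat_diff)
  have B: "(real k + 1 - real j) * m j \<le> B"
    using sum_bounded_below[of "{j..<Suc k}" "m j" m] mono' j unfolding B_def by (simp add: of_nat_diff add.commute[of 1])
  have "A + B = (\<Sum>i=1..<Suc k. m i)"
    unfolding A_def B_def using j by (intro sum.atLeastLessThan_concat) auto
  also have "\<dots> = mean (indicator {loc k 1..<loc k (Suc k)})"
    using split[of 1 "Suc k"] by simp
  \<comment> \<open>By \<open>AE_inside\<close> no mass lies outside the slots; the last one extends
    past \<open>loc k k\<close> and so contains it.\<close>
  also have "\<dots> = mean (\<lambda>_. 1)"
    unfolding mean_def
  proof (rule integral_cong_AE)
    note [measurable] = X
    show "(\<lambda>\<omega>. \<Sum>i=1..l. indicator {loc k 1..<loc k (Suc k)} (X i \<omega>) :: real) \<in> borel_measurable M"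
      by measurable
    have "AE \<omega> in M. \<forall>i\<in>{1..l}. loc k 1 \<le> X i \<omega> \<and> X i \<omega> \<le> loc k k"
      by (intro AE_finite_allI AE_inside) auto
    then show "AE \<omega> in M. (\<Sum>i=1..l. indicator {loc k 1..<loc k (Suc k)} (X i \<omega>)) = (\<Sum>i=1..l. 1 :: real)"
    proof eventually_elim
      case (elim \<omega>)
      have "loc k k < loc k (Suc k)" using k1 by (intro loc_less) auto
      with elim show ?case by (intro sum.cong) (force simp: indicator_def)+
    qed
  qed auto
  finally have AB: "A + B = real l" by (simp add: mean_const)
  \<comment> \<open>Both \<open>A\<close> and \<open>B\<close> are compared with multiples of
    \<open>m j\<close>; cross-multiplying eliminates it.\<close>
  have "real l * (real k + 1 - real j) = (real k + 1 - real j) * B + (real k + 1 - real j) * A"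
    unfolding AB[symmetric] by (simp add: algebra_simps)
  also have "\<dots> \<le> (real k + 1 - real j) * B + (real k + 1 - real j) * ((real j - 1) * m j)"
    using A j by (intro add_left_mono mult_left_mono) auto
  also have "\<dots> = (real k + 1 - real j) * B + (real j - 1) * ((real k + 1 - real j) * m j)"
    by simp
  also have "\<dots> \<le> (real k + 1 - real j) * B + (real j - 1) * B"
    using B j by (intro add_left_mono mult_left_mono) auto
  also have "\<dots> = real k * B"
    by (simp add: algebra_simps)
  finally have "(real k + 1 - real j) * (real l / real k) \<le> B"
    using k1 by (simp add: field_simps)
  also have "B = mean (indicator {loc k j..<loc k (Suc k)})"
    using split[of j "Suc k"] j unfolding B_def by simp
  also have "\<dots> \<le> mean (indicator {loc k j..})"
    by (rule mean_mono[where B = 1 and C = 1]) (auto simp: indicator_def)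
  finally show ?thesis .
qed

lemma mean_tails_sum:
  "mean (indicator {c}) = mean (indicator {c..}) + mean (indicator {..c}) - real l"
proof -
  have "mean (indicator {c}) = mean (\<lambda>a. (indicator {c..} a + 1 * indicator {..c} a) + (-1) * 1)"
    by (intro arg_cong[where f = mean] ext) (auto simp: indicator_def)
  also have "\<dots> = mean (\<lambda>a. indicator {c..} a + 1 * indicator {..c} a) + (-1) * mean (\<lambda>_. 1)"
    by (rule mean_linear[where B = 2 and C = 1]) (auto simp: indicator_def)
  also have "mean (\<lambda>a. indicator {c..} a + 1 * indicator {..c} a) = mean (indicator {c..}) + 1 * mean (indicator {..c})"
    by (rule mean_linear[where B = 1 and C = 1]) (auto simp: indicator_def)
  finally show ?thesis by (simp add: mean_const)
qed

lemma mean_location: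
  assumes j: "j \<in> {1..k}"
  shows "mean (indicator {loc k j}) = real l / real k"
proof -
  interpret R: optimal_facilities M "\<lambda>i \<omega>. 1 - X i \<omega>" l k
    by (rule reflected)
  have ge: "real l / real k \<le> mean (indicator {loc k i})" if i: "i \<in> {1..k}" for i
  proof -
    have i': "Suc k - i \<in> {1..k}" using i by auto
    have "loc k (Suc k - i) = 1 - loc k i"
      using i by (auto simp: loc_def field_simps of_nat_diff)
    then have "R.mean (indicator {loc k (Suc k - i)..}) = mean (indicator {..loc k i})"
      unfolding R.mean_def mean_def
      by (intro Bochner_Integration.integral_cong sum.cong) (auto simp: indicator_def)
    then have "real i * (real l / real k) \<le> mean (indicator {..loc k i})"
      using R.mean_tail[OF i'] i by (simp add: of_nat_diff)
    moreover have "(real k + 1 - real i) * (real l / real k) \<le> mean (indicator {loc k i..})"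
      by (rule mean_tail[OF i])
    moreover have "(real k + 1 - real i) * (real l / real k) + real i * (real l / real k) - real l = real l / real k"
      using k1 by (simp add: field_simps)
    ultimately show ?thesis
      using mean_tails_sum[of "loc k i"] by linarith
  qed
  \<comment> \<open>The \<open>k\<close> distinct points carry total mass at most \<open>l\<close>,
    so none of the lower bounds l / k can be strict.\<close>
  have "(\<Sum>i=1..k. mean (indicator {loc k i})) = mean (\<lambda>a. \<Sum>i=1..k. indicator {loc k i} a)"
    unfolding mean_def
  proof (subst Bochner_Integration.integral_sum[symmetric])
    show "integrable M (\<lambda>\<omega>. \<Sum>r=1..l. indicator {loc k i} (X r \<omega>) :: real)" for i
      by (intro Bochner_Integration.integrable_sum integrable_mean[where B = 1]) (auto simp: indicator_def)
  qed (intro Bochner_Integration.integral_cong refl sum.swap)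
  also have "\<dots> \<le> mean (\<lambda>_. 1)"
  proof -
    have "(\<Sum>i=1..k. indicator {loc k i} a) \<le> (1 :: real)" for a
    proof (cases "\<exists>i\<in>{1..k}. a = loc k i")
      case True
      then obtain i where i: "i \<in> {1..k}" "a = loc k i" by auto
      then have "(\<Sum>r=1..k. indicator {loc k r} a) = (\<Sum>r=1..k. if r = i then 1 else 0 :: real)"
        using loc_less[OF k1] by (intro sum.cong) (auto simp: indicator_def neq_iff)
      then show ?thesis using i by simp
    next
      case False
      then have "(\<Sum>i=1..k. indicator {loc k i} a) = (0 :: real)"
        by (intro sum.neutral) auto
      then show ?thesis by simp
    qed
    then show ?thesis
      by (intro mean_mono[where B = 1 and C = 1]) (auto simp: abs_le_iff intro: order.trans[OF _ sum_nonneg])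
  qed
  finally have le: "(\<Sum>i=1..k. mean (indicator {loc k i})) \<le> real l"
    by (simp add: mean_const)
  have "(\<Sum>i=1..k. real l / real k) = real l" using k1 by simp
  then show ?thesis
    using le ge j sum_strict_mono_ex1[of "{1..k}" "\<lambda>_. real l / real k" "\<lambda>i. mean (indicator {loc k i})"]
    by (metis (no_types, lifting) finite_atLeastAtMost linorder_not_le order_le_less)
qed

end

section \<open>Equilibria\<close>

text \<open>An increasing tuple is the sorted enumeration of its set of values, so the set
  determines the tuple.\<close>

lemma map_upt_pure_strategy:
  assumes "s \<in> pure_strategies n"
  shows "map s [1..<Suc n] = sorted_list_of_set (facilities n s)"
proof -
  have mono: "strict_mono_on {1..n} s" using assms by (simp add: pure_strategies_def)
  have "sorted_wrt (<) (map s [1..<Suc n])"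
    unfolding sorted_wrt_map
    by (rule sorted_wrt_mono_rel[OF _ sorted_wrt_upt]) (use mono in \<open>auto simp: strict_mono_on_def\<close>)
  then have "sorted (map s [1..<Suc n])" "distinct (map s [1..<Suc n])"
    by (simp_all add: strict_sorted_iff)
  then have "sorted_list_of_set (set (map s [1..<Suc n])) = map s [1..<Suc n]"
    by (rule sorted_list_of_set.idem_if_sorted_distinct)
  moreover have "set (map s [1..<Suc n]) = facilities n s"
    by (simp only: set_map set_upt facilities_def atLeastLessThanSuc_atLeastAtMost)
  ultimately show ?thesis by simp
qed

lemma facilities_inj_on: "inj_on (facilities n) (pure_strategies n)"
proof (rule inj_onI)
  fix s s' assume s: "s \<in> pure_strategies n" "s' \<in> pure_strategies n" "facilities n s = facilities n s'"
  then have "map s [1..<Suc n] = map s' [1..<Suc n]"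
    by (simp only: map_upt_pure_strategy)
  then have "\<forall>i\<in>{1..n}. s i = s' i"
    by (simp only: map_eq_conv set_upt atLeastLessThanSuc_atLeastAtMost)
  then show "s = s'"
    using s(1,2) by (intro PiE_ext[of s "{1..n}" "\<lambda>_. {0..1}"]) (auto simp: pure_strategies_def)
qed

lemma facilities_surj:
  assumes "finite F" "F \<subseteq> {0..1}" "card F = n"
  obtains s where "s \<in> pure_strategies n" "facilities n s = F"
proof
  let ?L = "sorted_list_of_set F"
  \<comment> \<open>List positions start at 0, coordinates of a strategy at 1.\<close>
  define s where "s = (\<lambda>i\<in>{1..n}. ?L ! (i - 1))"
  have len: "length ?L = n" using assms by simp
  have s: "s i = ?L ! (i - 1)" if "i \<in> {1..n}" for i
    using that by (simp add: s_def)
  have fac: "facilities n s = (\<lambda>i. ?L ! i) ` {0..<n}"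
    unfolding facilities_def
  proof safe
    fix i assume i: "i \<in> {1..n}"
    then show "s i \<in> (\<lambda>i. ?L ! i) ` {0..<n}" using s[OF i] by (intro image_eqI[of _ _ "i - 1"]) auto
  next
    fix i assume "i \<in> {0..<n}"
    then show "?L ! i \<in> s ` {1..n}" using s[of "Suc i"] by (intro image_eqI[of _ _ "Suc i"]) auto
  qed
  also have "\<dots> = set ?L" using len by (metis list.set_map map_nth set_upt)
  finally show F: "facilities n s = F" using assms by simp
  have "sorted_wrt (<) ?L" by simp
  then have "strict_mono_on {1..n} s"
    unfolding strict_mono_on_def using s len by (auto simp: sorted_wrt_iff_nth_less)
  moreover have "s \<in> {1..n} \<rightarrow>\<^sub>E {0..1}"
    using F assms(2) by (auto simp: facilities_def s_def)
  ultimately show "s \<in> pure_strategies n" by (simp add: pure_strategies_def)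
qed

lemma facilities_pure_strategies:
  assumes "s \<in> pure_strategies n"
  shows "finite (facilities n s)" "facilities n s \<subseteq> {0..1}" "card (facilities n s) = n"
    and "inj_on s {1..n}" "1 \<le> n \<Longrightarrow> facilities n s \<noteq> {}"
proof -
  show "finite (facilities n s)" "1 \<le> n \<Longrightarrow> facilities n s \<noteq> {}" by (auto simp: facilities_def)
  show "facilities n s \<subseteq> {0..1}" using assms by (auto simp: facilities_def pure_strategies_def PiE_iff)
  show inj: "inj_on s {1..n}" using assms by (auto simp: pure_strategies_def intro: strict_mono_on_imp_inj_on)
  show "card (facilities n s) = n" using inj by (simp add: facilities_def card_image)
qed

lemma pure_payoff_eq_gain:
  assumes "s1 \<in> pure_strategies l" "s2 \<in> pure_strategies k" "1 \<le> l" "1 \<le> k"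
  shows "pure_payoff l k 1 (s1, s2) = gain (facilities l s1) (facilities k s2)"
    and "pure_payoff l k 2 (s1, s2) = 1 - gain (facilities l s1) (facilities k s2)"
proof -
  note fac = facilities_pure_strategies[OF assms(1)] facilities_pure_strategies[OF assms(2)]
  show "pure_payoff l k 1 (s1, s2) = gain (facilities l s1) (facilities k s2)"
    using fac assms by (simp add: pure_payoff_def gain_def closest_players_share Let_def del: One_nat_def)
  have swap: "share (facilities k s2) (facilities l s1) = (\<lambda>t. 1 - share (facilities l s1) (facilities k s2) t)"
    using fac assms by (intro ext share_swap) auto
  have "pure_payoff l k 2 (s1, s2) = gain (facilities k s2) (facilities l s1)"
    unfolding pure_payoff_def gain_def Let_def fst_conv snd_conv using fac assms
    by (simp add: closest_players_share swap)
  then show "pure_payoff l k 2 (s1, s2) = 1 - gain (facilities l s1) (facilities k s2)"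
    using gain_swap[of "facilities l s1" "facilities k s2"] fac assms by simp
qed

lemma measurable_coordinate:
  assumes "i \<in> {1..n}"
  shows "(\<lambda>s. s i) \<in> borel_measurable (strategy_space n)"
  unfolding strategy_space_def using assms by (intro measurable_restrict_space1) simp

lemma mixed_strategies_sets: "x \<in> mixed_strategies n \<Longrightarrow> sets x = sets (strategy_space n)"
  by (simp add: mixed_strategies_def)

lemma mixed_strategies_space: "x \<in> mixed_strategies n \<Longrightarrow> space x = pure_strategies n"
  using sets_eq_imp_space_eq[of x "strategy_space n"]
  by (simp add: mixed_strategies_def space_strategy_space)

lemma mixed_strategies_measurable:
  "x \<in> mixed_strategies n \<Longrightarrow> i \<in> {1..n} \<Longrightarrow> (\<lambda>s. s i) \<in> borel_measurable x"
  using measurable_coordinate[of i n] measurable_cong_sets[OF mixed_strategies_sets[of x n] refl] by blast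

section \<open>The constant-sum game and sufficiency of the conditions\<close>

locale game =
  fixes l k :: nat
  assumes lk: "1 \<le> l" "l \<le> k"
begin

definition u :: "(nat \<Rightarrow> real) \<Rightarrow> (nat \<Rightarrow> real) \<Rightarrow> real" where
  "u s1 s2 = gain (facilities l s1) (facilities k s2)"

definition U :: "(nat \<Rightarrow> real) measure \<Rightarrow> (nat \<Rightarrow> real) measure \<Rightarrow> real" where
  "U x1 x2 = (\<integral>(s1, s2). u s1 s2 \<partial>(x1 \<Otimes>\<^sub>M x2))"

lemma k1: "1 \<le> k" using lk by simp

lemma u_bounds: "0 \<le> u s1 s2" "u s1 s2 \<le> 1"
  by (simp_all add: u_def gain_bounds facilities_def)

lemma measurable_u:
  assumes "x1 \<in> mixed_strategies l" "x2 \<in> mixed_strategies k"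
  shows "(\<lambda>(s1, s2). u s1 s2) \<in> borel_measurable (x1 \<Otimes>\<^sub>M x2)"
  unfolding u_def facilities_def split_beta'
  by (intro measurable_gain measurable_compose[OF measurable_fst mixed_strategies_measurable[OF assms(1)]]
      measurable_compose[OF measurable_snd mixed_strategies_measurable[OF assms(2)]]) auto

lemma measurable_u1:
  assumes "x1 \<in> mixed_strategies l"
  shows "(\<lambda>s1. u s1 s2) \<in> borel_measurable x1"
  unfolding u_def facilities_def
  by (intro measurable_gain mixed_strategies_measurable[OF assms]) auto

lemma measurable_u2:
  assumes "x2 \<in> mixed_strategies k"
  shows "(\<lambda>s2. u s1 s2) \<in> borel_measurable x2"
  unfolding u_def facilities_def
  by (intro measurable_gain mixed_strategies_measurable[OF assms]) auto

lemma integrable_mixed: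
  assumes x: "x \<in> mixed_strategies n" and f: "f \<in> borel_measurable x" "\<And>s. s \<in> pure_strategies n \<Longrightarrow> \<bar>f s\<bar> \<le> B"
  shows "integrable x (f :: _ \<Rightarrow> real)"
proof -
  interpret prob_space x using x by (simp add: mixed_strategies_def)
  show ?thesis
    using f mixed_strategies_space[OF x] by (intro integrable_const_bound[where B = B] AE_I2) auto
qed

lemma
  assumes x: "x1 \<in> mixed_strategies l" "x2 \<in> mixed_strategies k"
  shows payoff_1: "payoff l k 1 x1 x2 = U x1 x2"
    and payoff_2: "payoff l k 2 x1 x2 = 1 - U x1 x2"
    and U_fst: "U x1 x2 = (\<integral>s1. \<integral>s2. u s1 s2 \<partial>x2 \<partial>x1)"
    and U_snd: "U x1 x2 = (\<integral>s2. \<integral>s1. u s1 s2 \<partial>x1 \<partial>x2)"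
proof -
  interpret P1: prob_space x1 using x by (simp add: mixed_strategies_def)
  interpret P2: prob_space x2 using x by (simp add: mixed_strategies_def)
  interpret pair_prob_space x1 x2 ..
  have int: "integrable (x1 \<Otimes>\<^sub>M x2) (\<lambda>(s1, s2). u s1 s2)"
    by (rule P.integrable_const_bound[where B = 1])
       (use measurable_u[OF x] u_bounds in \<open>auto simp: split_beta'\<close>)
  have space: "space (x1 \<Otimes>\<^sub>M x2) = pure_strategies l \<times> pure_strategies k"
    using x by (simp add: space_pair_measure mixed_strategies_space)
  show "payoff l k 1 x1 x2 = U x1 x2"
    unfolding payoff_def U_def using space pure_payoff_eq_gain(1) lk k1
    by (intro Bochner_Integration.integral_cong) (auto simp: u_def)
  have "payoff l k 2 x1 x2 = (\<integral>s. 1 - (case s of (s1, s2) \<Rightarrow> u s1 s2) \<partial>(x1 \<Otimes>\<^sub>M x2))"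
    unfolding payoff_def U_def using space pure_payoff_eq_gain(2) lk k1
    by (intro Bochner_Integration.integral_cong) (auto simp: u_def)
  also have "\<dots> = 1 - U x1 x2"
    unfolding U_def using int by (subst Bochner_Integration.integral_diff) (auto simp: P.prob_space)
  finally show "payoff l k 2 x1 x2 = 1 - U x1 x2" .
  show "U x1 x2 = (\<integral>s1. \<integral>s2. u s1 s2 \<partial>x2 \<partial>x1)"
    unfolding U_def using integral_fst'[OF int] by simp
  show "U x1 x2 = (\<integral>s2. \<integral>s1. u s1 s2 \<partial>x1 \<partial>x2)"
    unfolding U_def using integral_snd[of u] int by simp
qed

lemma U_point_mass_1:
  assumes "s \<in> pure_strategies l" "x2 \<in> mixed_strategies k"
  shows "U (point_mass l s) x2 = (\<integral>s2. u s s2 \<partial>x2)"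
proof -
  have p: "point_mass l s \<in> mixed_strategies l"
    using assms(1) by (rule point_mass_in_mixed_strategies)
  have "(\<integral>s1. u s1 s2 \<partial>point_mass l s) = u s s2" for s2
    unfolding point_mass_def using measurable_u1[OF p, of s2] assms(1)
    by (intro integral_return) (simp_all add: space_strategy_space point_mass_def)
  then show ?thesis by (simp add: U_snd[OF p assms(2)])
qed

lemma U_point_mass_2:
  assumes "x1 \<in> mixed_strategies l" "s \<in> pure_strategies k"
  shows "U x1 (point_mass k s) = (\<integral>s1. u s1 s \<partial>x1)"
proof -
  have p: "point_mass k s \<in> mixed_strategies k"
    using assms(2) by (rule point_mass_in_mixed_strategies)
  have "(\<integral>s2. u s1 s2 \<partial>point_mass k s) = u s1 s" for s1
    unfolding point_mass_def using measurable_u2[OF p, of s1] assms(2)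
    by (intro integral_return) (simp_all add: space_strategy_space point_mass_def)
  then show ?thesis by (simp add: U_fst[OF assms(1) p])
qed

text \<open>Since the payoffs add up to 1, equilibria are exactly the saddle points of
  \<open>U\<close>.\<close>

lemma nash_iff:
  assumes "x1 \<in> mixed_strategies l" "x2 \<in> mixed_strategies k"
  shows "nash_equilibrium l k x1 x2 \<longleftrightarrow>
    (\<forall>y\<in>mixed_strategies l. U y x2 \<le> U x1 x2) \<and> (\<forall>y\<in>mixed_strategies k. U x1 x2 \<le> U x1 y)"
  unfolding nash_equilibrium_def using assms by (simp add: payoff_1 payoff_2 not_less del: One_nat_def)

lemma U_soc_opt_le:
  assumes "x1 \<in> mixed_strategies l"
  shows "U x1 (point_mass k (soc_opt k)) \<le> real l / (2 * real k)"
proof -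
  interpret prob_space x1 using assms by (simp add: mixed_strategies_def)
  have "u s (soc_opt k) \<le> real l / (2 * real k)" if "s \<in> pure_strategies l" for s
    using gain_soc_opt_le_half[OF k1 facilities_pure_strategies(1,2)[OF that]] facilities_pure_strategies(3)[OF that]
    by (simp add: u_def facilities_soc_opt)
  moreover have "integrable x1 (\<lambda>s. u s (soc_opt k))"
    by (rule integrable_mixed[OF assms measurable_u1[OF assms], where B = 1]) (simp add: u_bounds)
  ultimately have "(\<integral>s. u s (soc_opt k) \<partial>x1) \<le> (\<integral>s. real l / (2 * real k) \<partial>x1)"
    using mixed_strategies_space[OF assms] by (intro integral_mono) auto
  then show ?thesis
    by (simp add: U_point_mass_2[OF assms soc_opt_in_pure_strategies] prob_space)
qed

text \<open>Any \<open>k\<close> facilities earn at most 1/2 against o^k, and strictly less if they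
  differ from it. By constant sum o^k earns the rest, which its cell gains dominate.\<close>

lemma half_le_sum_cell_gain:
  assumes "s \<in> pure_strategies k"
  shows "1 / 2 \<le> (\<Sum>j=1..k. cell_gain k j (facilities k s))"
    and "s \<noteq> soc_opt k \<Longrightarrow> 1 / 2 < (\<Sum>j=1..k. cell_gain k j (facilities k s))"
proof -
  let ?F = "facilities k s" and ?G = "loc k ` {1..k}"
  note fac = facilities_pure_strategies[OF assms]
  have swap: "gain ?G ?F = 1 - gain ?F ?G"
    using fac k1 by (intro gain_swap) auto
  have le: "gain ?G ?F \<le> (\<Sum>j=1..k. cell_gain k j ?F)"
    using k1 fac by (intro gain_soc_opt_le_sum_cell_gain)
  have "gain ?F ?G \<le> 1 / 2"
    using gain_soc_opt_le_half[OF k1 fac(1,2)] fac(3) k1 by simp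
  then show "1 / 2 \<le> (\<Sum>j=1..k. cell_gain k j ?F)"
    using le swap by linarith
  assume "s \<noteq> soc_opt k"
  then have "?F \<noteq> ?G"
    using inj_onD[OF facilities_inj_on, of k s "soc_opt k"] assms soc_opt_in_pure_strategies facilities_soc_opt by metis
  then have "gain ?F ?G < 1 / 2"
    using gain_soc_opt_less_half[OF k1 fac(1-3)] by simp
  then show "1 / 2 < (\<Sum>j=1..k. cell_gain k j ?F)"
    using le swap by linarith
qed

lemma soc_opt_eq_loc: "j \<in> {1..k} \<Longrightarrow> soc_opt k j = loc k j"
  by (simp add: soc_opt_def loc_def)

text \<open>A pure strategy secures the cell gains of the optimal locations it occupies. Their
  expected sum depends only on the expected numbers l / k, whatever the joint distribution, and is
  therefore l / k times a sum of at least 1/2.\<close>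

lemma SOI_u_ge:
  assumes "SOI_strategy l k x1" and T: "T \<in> pure_strategies k"
  shows "real l / (2 * real k) \<le> (\<integral>s. u s T \<partial>x1)"
proof -
  have x: "x1 \<in> mixed_strategies l" and soi: "\<And>j. j \<in> {1..k} \<Longrightarrow> expected_facilities l x1 {loc k j} = real l / real k"
    using assms(1) by (auto simp: SOI_strategy_def soc_opt_eq_loc)
  interpret prob_space x1 using x by (simp add: mixed_strategies_def)
  let ?c = "\<lambda>j. cell_gain k j (facilities k T)"
  note [measurable] = mixed_strategies_measurable[OF x]
  have int: "integrable x1 (\<lambda>s. (\<Sum>i=1..l. indicator {a} (s i)) * c :: real)" for a c :: real
  proof (intro integrable_mult_left Bochner_Integration.integrable_sum)
    fix i assume "i \<in> {1..l}"
    then show "integrable x1 (\<lambda>s. indicator {a} (s i) :: real)"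
      by (intro integrable_mixed[OF x, where B = 1]) (auto simp: indicator_def)
  qed
  have "real l / (2 * real k) = real l / real k * (1 / 2)" by simp
  also have "\<dots> \<le> real l / real k * (\<Sum>j=1..k. ?c j)"
    using half_le_sum_cell_gain(1)[OF T] by (intro mult_left_mono) auto
  also have "\<dots> = (\<Sum>j=1..k. expected_facilities l x1 {loc k j} * ?c j)"
    using soi by (simp add: sum_distrib_left)
  also have "\<dots> = (\<integral>s. (\<Sum>j=1..k. (\<Sum>i=1..l. indicator {loc k j} (s i)) * ?c j) \<partial>x1)"
    unfolding expected_facilities_def using int by (subst Bochner_Integration.integral_sum) auto
  also have "\<dots> \<le> (\<integral>s. u s T \<partial>x1)"
  proof (rule integral_mono)
    show "integrable x1 (\<lambda>s. u s T)"
      by (rule integrable_mixed[OF x measurable_u1[OF x], where B = 1]) (simp add: u_bounds)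
    fix s assume "s \<in> space x1"
    then have s: "s \<in> pure_strategies l" using mixed_strategies_space[OF x] by simp
    let ?J = "{j \<in> {1..k}. loc k j \<in> facilities l s}"
    \<comment> \<open>The coordinates are distinct, so the number of facilities at a point is 0 or
      1.\<close>
    have "(\<Sum>i=1..l. indicator {a} (s i)) = (indicator (facilities l s) a :: real)" for a
    proof -
      have "(\<Sum>i=1..l. indicator {a} (s i) :: real) = (\<Sum>b\<in>s ` {1..l}. indicator {a} b)"
        using facilities_pure_strategies(4)[OF s] by (simp add: sum.reindex)
      also have "\<dots> = indicator (facilities l s) a"
        unfolding facilities_def indicator_def by (simp add: sum.delta')
      finally show ?thesis .
    qed
    then have "(\<Sum>j=1..k. (\<Sum>i=1..l. indicator {loc k j} (s i)) * ?c j) = (\<Sum>j=1..k. if loc k j \<in> facilities l s then ?c j else 0)"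
      by (intro sum.cong) (auto simp: indicator_def)
    also have "\<dots> = (\<Sum>j\<in>?J. ?c j)"
      by (intro sum.inter_filter[symmetric]) simp
    also have "\<dots> \<le> u s T"
      unfolding u_def using facilities_pure_strategies(1)[OF s] facilities_pure_strategies(1)[OF T]
      by (intro sum_cell_gain_le) auto
    finally show "(\<Sum>j=1..k. (\<Sum>i=1..l. indicator {loc k j} (s i)) * ?c j) \<le> u s T" .
  qed (use int in auto)
  finally show ?thesis .
qed

text \<open>Against o^k player 1 never gets more than l / (2k), and \<open>x1\<close> guarantees
  that much against every strategy of player 2: a saddle point.\<close>

lemma SOI_imp_nash:
  assumes "SOI_strategy l k x1"
  shows "nash_equilibrium l k x1 (point_mass k (soc_opt k))"
proof -
  let ?o = "point_mass k (soc_opt k)"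
  have x: "x1 \<in> mixed_strategies l" using assms by (simp add: SOI_strategy_def)
  have o: "?o \<in> mixed_strategies k"
    by (intro point_mass_in_mixed_strategies soc_opt_in_pure_strategies)
  have ge: "real l / (2 * real k) \<le> U x1 y" if y: "y \<in> mixed_strategies k" for y
  proof -
    interpret P1: prob_space x1 using x by (simp add: mixed_strategies_def)
    interpret prob_space y using y by (simp add: mixed_strategies_def)
    have "(\<integral>T. real l / (2 * real k) \<partial>y) \<le> (\<integral>T. \<integral>s. u s T \<partial>x1 \<partial>y)"
    proof (rule integral_mono)
      interpret pair_prob_space x1 y ..
      have "integrable (x1 \<Otimes>\<^sub>M y) (\<lambda>(s1, s2). u s1 s2)"
        by (rule P.integrable_const_bound[where B = 1])
           (use measurable_u[OF x y] u_bounds in \<open>auto simp: split_beta'\<close>)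
      then show "integrable y (\<lambda>T. \<integral>s. u s T \<partial>x1)" by (rule integrable_snd)
    qed (use SOI_u_ge[OF assms] mixed_strategies_space[OF y] in auto)
    then show ?thesis by (simp add: U_snd[OF x y] prob_space)
  qed
  show ?thesis
    unfolding nash_iff[OF x o]
    using U_soc_opt_le[OF x] U_soc_opt_le ge[OF o] ge by (meson order_trans)
qed

end

text \<open>Downward induction from \<open>J = A\<close>: removing an element with the least value
  does not lower the average over \<open>J\<close>.\<close>

lemma subset_sum_ge_average:
  fixes c :: "'a \<Rightarrow> real"
  assumes "finite A" "l \<le> card A"
  shows "\<exists>J\<subseteq>A. card J = l \<and> real l * sum c A \<le> real (card A) * sum c J"
  using assms(2)
proof (induction l rule: inc_induct)
  case base
  then show ?case by auto
next
  case (step l)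
  then obtain J where J: "J \<subseteq> A" "card J = Suc l" "real (Suc l) * sum c A \<le> real (card A) * sum c J"
    by auto
  have fin: "finite J" "J \<noteq> {}" using J(1,2) assms(1) finite_subset by auto
  define m where "m = arg_min_on c J"
  have m: "m \<in> J" "\<And>j. j \<in> J \<Longrightarrow> c m \<le> c j"
    using arg_min_if_finite[OF fin, of c] unfolding m_def by force+
  have "real (Suc l) * c m \<le> sum c J"
    using sum_bounded_below[of J "c m" c] m(2) J(2) by simp
  then have le: "real l * sum c J \<le> real (Suc l) * (sum c J - c m)"
    by (simp add: algebra_simps)
  have "real (Suc l) * (real l * sum c A) = real l * (real (Suc l) * sum c A)"
    by (rule mult.left_commute)
  also have "\<dots> \<le> real l * (real (card A) * sum c J)"
    using J(3) by (intro mult_left_mono) auto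
  also have "\<dots> = real (card A) * (real l * sum c J)"
    by (rule mult.left_commute)
  also have "\<dots> \<le> real (card A) * (real (Suc l) * (sum c J - c m))"
    using le by (intro mult_left_mono) auto
  also have "\<dots> = real (Suc l) * (real (card A) * (sum c J - c m))"
    by (rule mult.left_commute)
  finally have "real (Suc l) * (real l * sum c A) \<le> real (Suc l) * (real (card A) * (sum c J - c m))" .
  then have "real l * sum c A \<le> real (card A) * (sum c J - c m)"
    by (simp only: mult_le_cancel_left_pos of_nat_0_less_iff zero_less_Suc)
  then show ?case
    using J m(1) fin by (intro exI[of _ "J - {m}"]) (auto simp: sum_diff1)
qed

lemma eq_point_massI:
  assumes x: "x \<in> mixed_strategies n" and s: "s \<in> pure_strategies n" and AE: "AE T in x. T = s"
  shows "x = point_mass n s"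
proof (rule measure_eqI)
  interpret prob_space x using x by (simp add: mixed_strategies_def)
  show "sets x = sets (point_mass n s)"
    using mixed_strategies_sets[OF x] by (simp add: point_mass_def)
  fix A assume A: "A \<in> sets x"
  \<comment> \<open>Almost surely the strategy is \<open>s\<close>, so \<open>A\<close> agrees up to
    a null set with the whole space or the empty set.\<close>
  have "emeasure x A = emeasure x (if s \<in> A then space x else {})"
    using AE A by (intro emeasure_eq_AE) auto
  also have "\<dots> = indicator A s"
    by (simp add: emeasure_space_1)
  also have "\<dots> = emeasure (point_mass n s) A"
    using A mixed_strategies_sets[OF x] by (simp add: point_mass_def)
  finally show "emeasure x A = emeasure (point_mass n s) A" .
qed

section \<open>Necessity of the conditions\<close>

context game
begin

context
  fixes x1 x2
  assumes x: "x1 \<in> mixed_strategies l" "x2 \<in> mixed_strategies k" and nash: "nash_equilibrium l k x1 x2"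
begin

lemma
  shows nash_1: "y \<in> mixed_strategies l \<Longrightarrow> U y x2 \<le> U x1 x2"
    and nash_2: "y \<in> mixed_strategies k \<Longrightarrow> U x1 x2 \<le> U x1 y"
  using nash nash_iff[OF x] by blast+

lemma nash_U_le: "U x1 x2 \<le> real l / (2 * real k)"
proof -
  have "U x1 x2 \<le> U x1 (point_mass k (soc_opt k))"
    by (intro nash_2 point_mass_in_mixed_strategies soc_opt_in_pure_strategies)
  then show ?thesis using U_soc_opt_le[OF x(1)] by linarith
qed

lemma integrable_cell_gain: "integrable x2 (\<lambda>T. cell_gain k j (facilities k T))" if "j \<in> {1..k}"
proof (rule integrable_mixed[OF x(2)])
  show "(\<lambda>T. cell_gain k j (facilities k T)) \<in> borel_measurable x2"
    unfolding facilities_def by (intro measurable_cell_gain mixed_strategies_measurable[OF x(2)]) auto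
  show "\<bar>cell_gain k j (facilities k T)\<bar> \<le> 1" for T
    using cell_gain_bounds[OF _ that, of "facilities k T"] by (simp add: facilities_def)
qed

text \<open>Player 1 can occupy the \<open>l\<close> most profitable cells.\<close>

lemma nash_U_ge: "real l / real k * (\<integral>T. (\<Sum>j=1..k. cell_gain k j (facilities k T)) \<partial>x2) \<le> U x1 x2"
proof -
  define c where "c j = (\<integral>T. cell_gain k j (facilities k T) \<partial>x2)" for j
  obtain J where J: "J \<subseteq> {1..k}" "card J = l" "real l * sum c {1..k} \<le> real k * sum c J"
    using subset_sum_ge_average[of "{1..k}" l c] lk by auto
  have "finite J" using J(1) finite_subset by blast
  have inj: "inj_on (loc k) J"
    using loc_less[OF k1] by (intro linorder_inj_onI) (auto simp: less_imp_neq)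
  have sub: "loc k ` J \<subseteq> {0..1}"
    using J(1) loc_mem by (intro image_subsetI) blast
  obtain s where s: "s \<in> pure_strategies l" "facilities l s = loc k ` J"
    using facilities_surj[OF _ sub, of l] J(2) \<open>finite J\<close> inj by (auto simp: card_image)
  have "real l / real k * (\<integral>T. (\<Sum>j=1..k. cell_gain k j (facilities k T)) \<partial>x2) = real l / real k * sum c {1..k}"
    unfolding c_def using integrable_cell_gain by (subst Bochner_Integration.integral_sum) auto
  also have "\<dots> \<le> sum c J"
    using J(3) k1 by (simp add: field_simps)
  also have "\<dots> = (\<integral>T. (\<Sum>j\<in>J. cell_gain k j (facilities k T)) \<partial>x2)"
    unfolding c_def using integrable_cell_gain J(1) by (subst Bochner_Integration.integral_sum) auto
  also have "\<dots> \<le> (\<integral>T. u s T \<partial>x2)"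
  proof (rule integral_mono)
    show "integrable x2 (\<lambda>T. \<Sum>j\<in>J. cell_gain k j (facilities k T))"
      using J(1) by (intro Bochner_Integration.integrable_sum integrable_cell_gain) blast
    show "integrable x2 (\<lambda>T. u s T)"
      by (rule integrable_mixed[OF x(2) measurable_u2[OF x(2)], where B = 1]) (simp add: u_bounds)
    show "(\<Sum>j\<in>J. cell_gain k j (facilities k T)) \<le> u s T" for T
      unfolding u_def s(2) using J(1) \<open>finite J\<close> by (intro sum_cell_gain_le) (auto simp: facilities_def)
  qed
  also have "\<dots> = U (point_mass l s) x2"
    using U_point_mass_1[OF s(1) x(2)] by simp
  also have "\<dots> \<le> U x1 x2"
    by (intro nash_1 point_mass_in_mixed_strategies s(1))
  finally show ?thesis .
qed

text \<open>\<open>nash_U_ge\<close> and \<open>nash_U_le\<close> force the expected sum of all cell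
  gains down to 1/2. The sum is at least 1/2 everywhere and larger off \<open>soc_opt k\<close>, so
  \<open>x2\<close> is concentrated there.\<close>

lemma nash_imp_soc_opt: "x2 = point_mass k (soc_opt k)"
proof (rule eq_point_massI[OF x(2) soc_opt_in_pure_strategies])
  interpret prob_space x2 using x by (simp add: mixed_strategies_def)
  let ?f = "\<lambda>T. (\<Sum>j=1..k. cell_gain k j (facilities k T)) - 1 / 2"
  have int: "integrable x2 (\<lambda>T. \<Sum>j=1..k. cell_gain k j (facilities k T))"
    using integrable_cell_gain by auto
  then have int': "integrable x2 ?f" by simp
  have f: "0 \<le> ?f T" "T \<noteq> soc_opt k \<Longrightarrow> 0 < ?f T" if "T \<in> space x2" for T
    using half_le_sum_cell_gain[of T] that mixed_strategies_space[OF x(2)] by auto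
  have nonneg: "AE T in x2. 0 \<le> ?f T"
    using f(1) by (rule AE_I2)
  have "real l / real k * (\<integral>T. (\<Sum>j=1..k. cell_gain k j (facilities k T)) \<partial>x2) \<le> real l / real k * (1 / 2)"
    using nash_U_ge nash_U_le by simp
  then have "(\<integral>T. (\<Sum>j=1..k. cell_gain k j (facilities k T)) \<partial>x2) \<le> 1 / 2"
    using lk by (subst (asm) mult_le_cancel_left_pos) auto
  then have "expectation ?f \<le> 0"
    using int by (subst Bochner_Integration.integral_diff) (auto simp: prob_space)
  with integral_nonneg_AE[OF nonneg] have "expectation ?f = 0" by linarith
  then have "AE T in x2. ?f T = 0"
    using integral_nonneg_eq_0_iff_AE[OF int' nonneg] by simp
  then show "AE T in x2. T = soc_opt k"
    using AE_space by eventually_elim (use f(2) in fastforce)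
qed

text \<open>\<open>nash_U_ge\<close> bounds the equilibrium payoff from below by l / (2k). Every set
  \<open>T\<close> of \<open>k\<close> points is a possible reply of player 2, and subadditivity
  turns the payoff against it into the sum of individual gains, so \<open>optimal_facilities\<close>
  applies to the coordinates of \<open>x1\<close>.\<close>

lemma nash_imp_SOI: "SOI_strategy l k x1"
proof -
  interpret P2: prob_space x2 using x by (simp add: mixed_strategies_def)
  interpret prob_space x1 using x by (simp add: mixed_strategies_def)
  have "real l / (2 * real k) = real l / real k * (\<integral>T. 1 / 2 \<partial>x2)"
    by (simp add: P2.prob_space)
  also have "\<dots> \<le> real l / real k * (\<integral>T. (\<Sum>j=1..k. cell_gain k j (facilities k T)) \<partial>x2)"
  proof (intro mult_left_mono integral_mono)
    show "integrable x2 (\<lambda>T. \<Sum>j=1..k. cell_gain k j (facilities k T))"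
      by (intro Bochner_Integration.integrable_sum integrable_cell_gain)
    show "1 / 2 \<le> (\<Sum>j=1..k. cell_gain k j (facilities k T))" if "T \<in> space x2" for T
      using that mixed_strategies_space[OF x(2)] by (intro half_le_sum_cell_gain(1)) simp
  qed auto
  also have "\<dots> \<le> U x1 x2" by (rule nash_U_ge)
  finally have U: "real l / (2 * real k) \<le> U x1 x2" .
  interpret optimal_facilities x1 "\<lambda>i s. s i" l k
  proof unfold_locales
    show "1 \<le> k" by (rule k1)
    show "random_variable borel (\<lambda>s. s i)" if "i \<in> {1..l}" for i
      using mixed_strategies_measurable[OF x(1) that] .
    show "s i \<in> {0..1}" if "i \<in> {1..l}" "s \<in> space x1" for i s
      using that mixed_strategies_space[OF x(1)] by (auto simp: pure_strategies_def PiE_iff)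
    fix T :: "real set" assume T: "finite T" "T \<subseteq> {0..1}" "card T = k"
    obtain t where t: "t \<in> pure_strategies k" "facilities k t = T"
      using facilities_surj[OF T] by blast
    have "U x1 x2 \<le> U x1 (point_mass k t)"
      by (intro nash_2 point_mass_in_mixed_strategies t(1))
    also have "\<dots> = (\<integral>s. u s t \<partial>x1)"
      by (rule U_point_mass_2[OF x(1) t(1)])
    also have "\<dots> \<le> expectation (\<lambda>s. \<Sum>i=1..l. gain {s i} T)"
    proof (rule integral_mono)
      show "integrable x1 (\<lambda>s. u s t)"
        by (rule integrable_mixed[OF x(1) measurable_u1[OF x(1)], where B = 1]) (simp add: u_bounds)
      show "integrable x1 (\<lambda>s. \<Sum>i=1..l. gain {s i} T)"
      proof (intro Bochner_Integration.integrable_sum integrable_mixed[OF x(1), where B = 1])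
        fix i assume "i \<in> {1..l}"
        note [measurable] = mixed_strategies_measurable[OF x(1) this] T(1)
        show "(\<lambda>s. gain {s i} T) \<in> borel_measurable x1" by measurable
        show "\<bar>gain {s i} T\<bar> \<le> 1" for s
          using gain_bounds[of "{s i}" T] T(1) by simp
      qed
      fix s assume "s \<in> space x1"
      then have s: "s \<in> pure_strategies l" using mixed_strategies_space[OF x(1)] by simp
      have "u s t \<le> (\<Sum>a\<in>facilities l s. gain {a} T)"
        unfolding u_def t(2) using facilities_pure_strategies(1)[OF s] T(1) by (rule gain_subadditive)
      also have "\<dots> = (\<Sum>i=1..l. gain {s i} T)"
        unfolding facilities_def using facilities_pure_strategies(4)[OF s] by (simp add: sum.reindex)
      finally show "u s t \<le> (\<Sum>i=1..l. gain {s i} T)" .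
    qed
    finally show "real l / (2 * real k) \<le> expectation (\<lambda>s. \<Sum>i=1..l. gain {s i} T)"
      using U by linarith
  qed
  show ?thesis
    using mean_location x(1) by (simp add: SOI_strategy_def soc_opt_eq_loc expected_facilities_def mean_def)
qed

end

end

theorem theorem2:
  fixes l k :: nat and x1 x2 :: "(nat \<Rightarrow> real) measure"
  assumes "1 \<le> l" and "l \<le> k"
    and "x1 \<in> mixed_strategies l" and "x2 \<in> mixed_strategies k"
  shows "nash_equilibrium l k x1 x2 \<longleftrightarrow>
           SOI_strategy l k x1 \<and> x2 = point_mass k (soc_opt k)"
proof -
  interpret game l k by unfold_locales fact+
  show ?thesis
    using nash_imp_SOI[OF assms(3,4)] nash_imp_soc_opt[OF assms(3,4)] SOI_imp_nash by blast
qed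

end
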